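(* Let $r\in C^\infty(J)$ be an admissible function and let $\Psi=(\Psi_0,\Psi_1,\dots,\Psi_{n+1})\colon M^k\to\mathbb{L}^{n+2}$ be a spacelike immersion with $\Psi_0(M^k)\subset J$ such that the function $$q_{\Psi_0}=\frac{k-\big(r''(\Psi_0)r(\Psi_0)+r'(\Psi_0)^2-1\big)\|\nabla\Psi_0\|^2}{r(\Psi_0)^2\big(1-r'(\Psi_0)^2\big)}$$ satisfies $q_{\Psi_0}>0$ on $M^k$. If $$\Delta\Psi+q_{\Psi_0}\,\mathbf{P}=0,\qquad\text{where}\quad \mathbf{P}=\big(r(\Psi_0)r'(\Psi_0),\Psi_1,\dots,\Psi_{n+1}\big),$$ then $\Psi$ realizes a stationary spacelike immersion in $Q(r)$; that is, $\Psi(M^k)\subset Q(r)$ and $\Psi\colon M^k\to Q(r)$ is stationary.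
   Context: $\mathbb{L}^{n+2}$ is $\mathbb{R}^{n+2}$ with coordinates $(t,x)=(t,x_1,\dots,x_{n+1})$ and the Lorentzian metric $\langle\,,\rangle=-dt^2+dx_1^2+\dots+dx_{n+1}^2$. Let $J\subset\mathbb{R}$ be an open interval with $0\in J$. A function $r\in C^\infty(J)$ is called admissible if $r(t)>0$ and $|r'(t)|<1$ for all $t\in J$. For such $r$, $Q(r)=\{(t,x)\in J\times\mathbb{R}^{n+1}: x_1^2+\dots+x_{n+1}^2=r(t)^2\}$, a hypersurface of $\mathbb{L}^{n+2}$ whose induced metric is Lorentzian. A spacelike immersion is an immersion of a $k$-dimensional manifold $M^k$ whose induced metric is Riemannian; $M^k$ is endowed with the induced metric. $\nabla$, $\Delta=\mathrm{div}\,\nabla$ and $\|\cdot\|$ are the gradient, Laplacian and norm of that metric, and $\Delta\Psi$ is computed componentwise. A spacelike immersion is stationary (in a given ambient Lorentzian manifold) if its mean curvature vector field (the normalized trace of its second fundamental form in that ambient manifold) vanishes identically. *)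

theory Defs
  imports "HOL-Analysis.Analysis"
begin

text \<open>For open \<open>S\<close> only: derivatives are two-sided ones of the ambient space.\<close>

fun C_k_on :: "nat \<Rightarrow> 'v set \<Rightarrow> ('v::real_normed_vector \<Rightarrow> 'w::real_normed_vector) \<Rightarrow> bool" where
  "C_k_on 0 S f \<longleftrightarrow> continuous_on S f"
| "C_k_on (Suc n) S f \<longleftrightarrow> (\<forall>x\<in>S. f differentiable (at x)) \<and>
     (\<forall>v. C_k_on n S (\<lambda>x. frechet_derivative f (at x) v))"

definition smooth_on :: "'v set \<Rightarrow> ('v::real_normed_vector \<Rightarrow> 'w::real_normed_vector) \<Rightarrow> bool" where
  "smooth_on S f \<longleftrightarrow> (\<forall>n. C_k_on n S f)"

definition partial_deriv :: "'i \<Rightarrow> (real^'i::finite \<Rightarrow> 'w::real_normed_vector) \<Rightarrow> real^'i \<Rightarrow> 'w" where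
  "partial_deriv i f x = frechet_derivative f (at x) (axis i 1)"

section \<open>Semi-Riemannian geometry in coordinates\<close>

text \<open>A metric on (an open part of) \<open>'v\<close> assigns to a point a bilinear form on \<open>'v\<close>.\<close>

type_synonym 'v metric_field = "'v \<Rightarrow> 'v \<Rightarrow> 'v \<Rightarrow> real"

definition pull_back :: "'w metric_field \<Rightarrow> ('v::real_normed_vector \<Rightarrow> 'w::real_normed_vector)
    \<Rightarrow> 'v metric_field" where
  "pull_back h f x v w = h (f x) (frechet_derivative f (at x) v) (frechet_derivative f (at x) w)"

definition metric_matrix :: "(real^'i::finite) metric_field \<Rightarrow> real^'i \<Rightarrow> real^'i^'i" where
  "metric_matrix g x = (\<chi> i j. g x (axis i 1) (axis j 1))"

definition inverse_metric :: "(real^'i::finite) metric_field \<Rightarrow> real^'i \<Rightarrow> real^'i^'i" where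
  "inverse_metric g x = matrix_inv (metric_matrix g x)"

text \<open>\<open>christoffel g x c a b\<close> is the Christoffel symbol of the Levi-Civita connection with upper
  index \<open>c\<close> and lower indices \<open>a\<close>, \<open>b\<close>.\<close>

definition christoffel :: "(real^'i::finite) metric_field \<Rightarrow> real^'i \<Rightarrow> 'i \<Rightarrow> 'i \<Rightarrow> 'i \<Rightarrow> real" where
  "christoffel g x c a b =
     (\<Sum>d\<in>UNIV. inverse_metric g x $ c $ d *
        (partial_deriv a (\<lambda>z. metric_matrix g z $ b $ d) x
         + partial_deriv b (\<lambda>z. metric_matrix g z $ a $ d) x
         - partial_deriv d (\<lambda>z. metric_matrix g z $ a $ b) x)) / 2"

definition gradient :: "(real^'i::finite) metric_field \<Rightarrow> (real^'i \<Rightarrow> real) \<Rightarrow> real^'i \<Rightarrow> real^'i" where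
  "gradient g f x = (\<chi> i. \<Sum>j\<in>UNIV. inverse_metric g x $ i $ j * partial_deriv j f x)"

text \<open>The divergence of \<open>Y\<close> is the trace of its covariant derivative.\<close>

definition divergence :: "(real^'i::finite) metric_field \<Rightarrow> (real^'i \<Rightarrow> real^'i) \<Rightarrow> real^'i \<Rightarrow> real" where
  "divergence g Y x =
     (\<Sum>i\<in>UNIV. partial_deriv i (\<lambda>z. Y z $ i) x + (\<Sum>j\<in>UNIV. christoffel g x i i j * Y x $ j))"

definition laplace_beltrami :: "(real^'i::finite) metric_field \<Rightarrow> (real^'i \<Rightarrow> real) \<Rightarrow> real^'i \<Rightarrow> real" where
  "laplace_beltrami g f = divergence g (gradient g f)"

definition spacelike_immersive_at :: "'w metric_field \<Rightarrow>
    ('v::real_normed_vector \<Rightarrow> 'w::real_normed_vector) \<Rightarrow> 'v \<Rightarrow> bool" where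
  "spacelike_immersive_at h u x \<longleftrightarrow>
     inj (frechet_derivative u (at x)) \<and> (\<forall>v. v \<noteq> 0 \<longrightarrow> pull_back h u x v v > 0)"

text \<open>For a map \<open>u\<close> into a coordinate domain with metric \<open>h\<close>: the ambient covariant derivative,
  along \<open>u\<close> and in direction \<open>i\<close>, of the coordinate field \<open>partial_deriv j u\<close>.\<close>

definition ambient_derivative :: "(real^'m::finite) metric_field \<Rightarrow> (real^'k::finite \<Rightarrow> real^'m) \<Rightarrow>
    'k \<Rightarrow> 'k \<Rightarrow> real^'k \<Rightarrow> real^'m" where
  "ambient_derivative h u i j x = partial_deriv i (partial_deriv j u) x +
     (\<chi> c. \<Sum>a\<in>UNIV. \<Sum>b\<in>UNIV. christoffel h (u x) c a b *
        partial_deriv i u x $ a * partial_deriv j u x $ b)"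

text \<open>Orthogonal projection onto the image of the differential of \<open>u\<close> at \<open>x\<close>.\<close>

definition tangential :: "(real^'m::finite) metric_field \<Rightarrow> (real^'k::finite \<Rightarrow> real^'m) \<Rightarrow>
    real^'k \<Rightarrow> real^'m \<Rightarrow> real^'m" where
  "tangential h u x w = (\<Sum>i\<in>UNIV. \<Sum>j\<in>UNIV.
     (inverse_metric (pull_back h u) x $ i $ j * h (u x) w (partial_deriv j u x)) *\<^sub>R partial_deriv i u x)"

definition second_fundamental_form :: "(real^'m::finite) metric_field \<Rightarrow> (real^'k::finite \<Rightarrow> real^'m) \<Rightarrow>
    'k \<Rightarrow> 'k \<Rightarrow> real^'k \<Rightarrow> real^'m" where
  "second_fundamental_form h u i j x =
     ambient_derivative h u i j x - tangential h u x (ambient_derivative h u i j x)"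

definition mean_curvature_vector :: "(real^'m::finite) metric_field \<Rightarrow> (real^'k::finite \<Rightarrow> real^'m) \<Rightarrow>
    real^'k \<Rightarrow> real^'m" where
  "mean_curvature_vector h u x = (1 / real CARD('k)) *\<^sub>R (\<Sum>i\<in>UNIV. \<Sum>j\<in>UNIV.
     inverse_metric (pull_back h u) x $ i $ j *\<^sub>R second_fundamental_form h u i j x)"

section \<open>Smooth manifolds\<close>

text \<open>A chart is a domain together with a coordinate map. The dimension is \<open>CARD('k)\<close>; atlases
  need not be maximal.\<close>

type_synonym ('a, 'k) chart = "'a set \<times> ('a \<Rightarrow> real^'k)"

definition smooth_manifold :: "'a topology \<Rightarrow> ('a, 'k::finite) chart set \<Rightarrow> bool" where
  "smooth_manifold X A \<longleftrightarrow> Hausdorff_space X \<and> second_countable X \<and>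
     (\<Union>(U, \<phi>)\<in>A. U) = topspace X \<and>
     (\<forall>(U, \<phi>)\<in>A. openin X U \<and> open (\<phi> ` U) \<and>
        homeomorphic_map (subtopology X U) (top_of_set (\<phi> ` U)) \<phi>) \<and>
     (\<forall>(U, \<phi>)\<in>A. \<forall>(V, \<psi>)\<in>A. smooth_on (\<phi> ` (U \<inter> V)) (\<psi> \<circ> inv_into U \<phi>))"

definition chart_image :: "('a, 'k::finite) chart \<Rightarrow> (real^'k) set" where
  "chart_image c = snd c ` fst c"

definition in_chart :: "('a, 'k::finite) chart \<Rightarrow> ('a \<Rightarrow> 'b) \<Rightarrow> real^'k \<Rightarrow> 'b" where
  "in_chart c f = f \<circ> inv_into (fst c) (snd c)"

text \<open>A metric on a manifold is given by its coordinate expressions \<open>G c\<close> in the charts \<open>c\<close>.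
  The Laplacian and the norm of the gradient at \<open>p\<close> do not depend on the chart around \<open>p\<close> in which
  they are computed, so an arbitrary one is chosen.\<close>

definition chart_at :: "('a, 'k::finite) chart set \<Rightarrow> 'a \<Rightarrow> ('a, 'k) chart" where
  "chart_at A p = (SOME c. c \<in> A \<and> p \<in> fst c)"

definition laplacian :: "('a, 'k::finite) chart set \<Rightarrow> (('a, 'k) chart \<Rightarrow> (real^'k) metric_field) \<Rightarrow>
    ('a \<Rightarrow> real) \<Rightarrow> 'a \<Rightarrow> real" where
  "laplacian A G f p =
     (let c = chart_at A p in laplace_beltrami (G c) (in_chart c f) (snd c p))"

definition gradient_norm :: "('a, 'k::finite) chart set \<Rightarrow> (('a, 'k) chart \<Rightarrow> (real^'k) metric_field) \<Rightarrow>
    ('a \<Rightarrow> real) \<Rightarrow> 'a \<Rightarrow> real" where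
  "gradient_norm A G f p =
     (let c = chart_at A p; x = snd c p; v = gradient (G c) (in_chart c f) x in sqrt (G c x v v))"

section \<open>Lorentz-Minkowski space and its submanifolds\<close>

text \<open>The Lorentz-Minkowski space of dimension \<open>n + 2\<close>, where \<open>CARD('m) = n + 1\<close>; the first
  factor is the time coordinate.\<close>

type_synonym 'm minkowski_space = "real \<times> (real^'m)"

definition minkowski :: "('m::finite minkowski_space) metric_field" where
  "minkowski p v w = - (fst v * fst w) + (\<Sum>i\<in>UNIV. snd v $ i * snd w $ i)"

definition spacelike_immersion :: "('a, 'k::finite) chart set \<Rightarrow> ('a \<Rightarrow> 'm::finite minkowski_space) \<Rightarrow> bool" where
  "spacelike_immersion A \<Psi> \<longleftrightarrow> (\<forall>c\<in>A. smooth_on (chart_image c) (in_chart c \<Psi>) \<and>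
     (\<forall>x\<in>chart_image c. spacelike_immersive_at minkowski (in_chart c \<Psi>) x))"

definition induced_metric :: "('a \<Rightarrow> 'm::finite minkowski_space) \<Rightarrow>
    ('a, 'k::finite) chart \<Rightarrow> (real^'k) metric_field" where
  "induced_metric \<Psi> c = pull_back minkowski (in_chart c \<Psi>)"

definition vector_laplacian :: "('a, 'k::finite) chart set \<Rightarrow> ('a \<Rightarrow> 'm::finite minkowski_space) \<Rightarrow>
    'a \<Rightarrow> 'm minkowski_space" where
  "vector_laplacian A \<Psi> p =
     (laplacian A (induced_metric \<Psi>) (\<lambda>q. fst (\<Psi> q)) p,
      \<chi> i. laplacian A (induced_metric \<Psi>) (\<lambda>q. snd (\<Psi> q) $ i) p)"

text \<open>Local parametrizations (inverse charts) of a hypersurface \<open>N\<close>, which has dimension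
  \<open>CARD('m)\<close>. Its induced metric has the coordinate expression \<open>pull_back minkowski y\<close>.\<close>

definition local_parametrization :: "('m::finite minkowski_space) set \<Rightarrow> (real^'m) set \<Rightarrow>
    (real^'m \<Rightarrow> 'm minkowski_space) \<Rightarrow> bool" where
  "local_parametrization N V y \<longleftrightarrow> open V \<and> smooth_on V y \<and>
     (\<forall>z\<in>V. inj (frechet_derivative y (at z))) \<and>
     openin (top_of_set N) (y ` V) \<and> (\<exists>y'. homeomorphism V (y ` V) y y')"

text \<open>Coordinate expression of \<open>\<Psi>\<close> as a map into \<open>N\<close>, and the set on which it is defined.\<close>

definition local_expression :: "('a, 'k::finite) chart \<Rightarrow> (real^'m::finite) set \<Rightarrow>
    (real^'m \<Rightarrow> 'm minkowski_space) \<Rightarrow> ('a \<Rightarrow> 'm minkowski_space) \<Rightarrow> real^'k \<Rightarrow> real^'m" where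
  "local_expression c V y \<Psi> = inv_into V y \<circ> in_chart c \<Psi>"

definition local_domain :: "('a, 'k::finite) chart \<Rightarrow> (real^'m::finite) set \<Rightarrow>
    (real^'m \<Rightarrow> 'm minkowski_space) \<Rightarrow> ('a \<Rightarrow> 'm minkowski_space) \<Rightarrow> (real^'k) set" where
  "local_domain c V y \<Psi> = {x \<in> chart_image c. in_chart c \<Psi> x \<in> y ` V}"

definition spacelike_immersion_into :: "('m::finite minkowski_space) set \<Rightarrow> 'a topology \<Rightarrow>
    ('a, 'k::finite) chart set \<Rightarrow> ('a \<Rightarrow> 'm minkowski_space) \<Rightarrow> bool" where
  "spacelike_immersion_into N X A \<Psi> \<longleftrightarrow> continuous_map X (top_of_set N) \<Psi> \<and>
     (\<forall>c\<in>A. \<forall>V y. local_parametrization N V y \<longrightarrow>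
        smooth_on (local_domain c V y \<Psi>) (local_expression c V y \<Psi>) \<and>
        (\<forall>x\<in>local_domain c V y \<Psi>.
           spacelike_immersive_at (pull_back minkowski y) (local_expression c V y \<Psi>) x))"

definition stationary_in :: "('m::finite minkowski_space) set \<Rightarrow>
    ('a, 'k::finite) chart set \<Rightarrow> ('a \<Rightarrow> 'm minkowski_space) \<Rightarrow> bool" where
  "stationary_in N A \<Psi> \<longleftrightarrow> (\<forall>c\<in>A. \<forall>V y. local_parametrization N V y \<longrightarrow>
     (\<forall>x\<in>local_domain c V y \<Psi>.
        mean_curvature_vector (pull_back minkowski y) (local_expression c V y \<Psi>) x = 0))"

section \<open>The hypersurface, and the data of the differential equation\<close>

definition admissible :: "real set \<Rightarrow> (real \<Rightarrow> real) \<Rightarrow> bool" where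
  "admissible J r \<longleftrightarrow> smooth_on J r \<and> (\<forall>t\<in>J. r t > 0 \<and> \<bar>deriv r t\<bar> < 1)"

definition Q :: "real set \<Rightarrow> (real \<Rightarrow> real) \<Rightarrow> ('m::finite minkowski_space) set" where
  "Q J r = {(t, x). t \<in> J \<and> (\<Sum>i\<in>UNIV. (x $ i)\<^sup>2) = (r t)\<^sup>2}"

definition q_fun :: "(real \<Rightarrow> real) \<Rightarrow> ('a, 'k::finite) chart set \<Rightarrow>
    ('a \<Rightarrow> 'm::finite minkowski_space) \<Rightarrow> 'a \<Rightarrow> real" where
  "q_fun r A \<Psi> p = (let t = fst (\<Psi> p) in
     (real CARD('k) - (deriv (deriv r) t * r t + (deriv r t)\<^sup>2 - 1) *
        (gradient_norm A (induced_metric \<Psi>) (\<lambda>q. fst (\<Psi> q)) p)\<^sup>2)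
     / ((r t)\<^sup>2 * (1 - (deriv r t)\<^sup>2)))"

definition P_field :: "(real \<Rightarrow> real) \<Rightarrow> ('a \<Rightarrow> 'm::finite minkowski_space) \<Rightarrow> 'a \<Rightarrow> 'm minkowski_space" where
  "P_field r \<Psi> p = (r (fst (\<Psi> p)) * deriv r (fst (\<Psi> p)), snd (\<Psi> p))"

end

theory Submission
  imports Defs
begin

text \<open>
  Write \<open>g\<close> for the induced metric and \<open>\<psi>\<close> for \<open>\<Psi>\<close> in a chart. By the product rule
  \<open>\<Delta>f = g\<^sup>i\<^sup>j \<partial>\<^sub>i\<partial>\<^sub>jf + C\<^sup>j \<partial>\<^sub>jf\<close>, and since \<open>g\<close> is pulled back from a flat metric, \<open>\<Delta>\<psi>\<close> is normal to
  \<open>M\<close>. As \<open>q > 0\<close>, the equation makes \<open>P\<close> normal to \<open>M\<close>. Differentiating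
  \<open>\<langle>P, \<partial>\<^sub>j\<psi>\<rangle> = 0\<close> in direction \<open>i\<close> and taking the trace gives
  \<open>k - (r'' r + r'\<^sup>2 - 1) \<parallel>\<nabla>\<Psi>\<^sub>0\<parallel>\<^sup>2 = - \<langle>P, g\<^sup>i\<^sup>j \<partial>\<^sub>i\<partial>\<^sub>j\<psi>\<rangle> = q \<langle>P, P\<rangle>\<close>. The left-hand side is
  \<open>q r\<^sup>2 (1 - r'\<^sup>2)\<close> by the choice of \<open>q\<close>, so \<open>|x|\<^sup>2 = r\<^sup>2\<close>.
  Along \<open>Q(r)\<close> the field \<open>P\<close> is normal to \<open>Q(r)\<close>, and the mean curvature in \<open>Q(r)\<close> is the
  \<open>Q(r)\<close>-tangential part of \<open>\<Delta>\<Psi>/k = - (q/k) P\<close>, which vanishes.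
\<close>

section \<open>Maps of class $C^k$\<close>

text \<open>The Laplacian at \<open>p\<close> is given only in the chart that
  \<open>chart_at\<close> picks for \<open>p\<close>, and neighbouring points may be assigned
  unrelated charts, while normality of the position field has to be differentiated in one fixed
  chart. Instead of proving that the Laplacian is invariant, the equation is weakened: the
  first-order part of the Laplacian is tangent to M, so \<open>hessian_trace\<close> equals -q P
  modulo tangent vectors. The chain rule changes the Hessian trace by tangent vectors only, so this
  form holds in every chart, and together with normality of P it yields both halves of the
  conclusion. Being an immersion into Q(r) is expressed through \<open>inv_into\<close>, so
  smoothness of local expressions has to be bootstrapped from their continuity. Being stationary is
  expressed through Christoffel symbols of a metric on Q(r) that is not positive definite, so the
  computations rest on nonzero Gram determinants; for Q(r) these come from P not being null
  there.\<close>

lemma C_k_on_cong: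
  assumes "open S" "\<And>x. x \<in> S \<Longrightarrow> f x = g x" "C_k_on n S f"
  shows "C_k_on n S g"
  using assms(2,3)
proof (induction n arbitrary: f g)
  case 0
  then show ?case by (simp cong: continuous_on_cong)
next
  case (Suc n)
  have d: "g differentiable at x" if "x \<in> S" for x
  proof -
    have "(f has_derivative frechet_derivative f (at x)) (at x)"
      using Suc.prems(2) that frechet_derivative_works by auto
    then have "(g has_derivative frechet_derivative f (at x)) (at x)"
      using has_derivative_transform_within_open[of f _ x UNIV S g] \<open>open S\<close> that Suc.prems(1) by auto
    then show ?thesis by (auto simp: differentiable_def)
  qed
  have e: "frechet_derivative f (at x) = frechet_derivative g (at x)" if "x \<in> S" for x
    using Suc.prems that \<open>open S\<close> by (intro frechet_derivative_transform_within_open[of f x S g]) auto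
  show ?case
    using d e Suc.prems(2) Suc.IH[of "\<lambda>x. frechet_derivative f (at x) v" "\<lambda>x. frechet_derivative g (at x) v" for v]
    by auto
qed

text \<open>By uniqueness of derivatives an explicit formula \<open>f'\<close> may stand in for
  \<open>frechet_derivative\<close>. The closure rules below thereby reduce to a differentiation
  rule and the induction hypothesis.\<close>

lemma C_k_on_SucI:
  assumes "open S" "\<And>x. x \<in> S \<Longrightarrow> (f has_derivative f' x) (at x)"
    and "\<And>v. C_k_on n S (\<lambda>x. f' x v)"
  shows "C_k_on (Suc n) S f"
proof -
  have "f differentiable at x" "f' x = frechet_derivative f (at x)" if "x \<in> S" for x
    using assms(2)[OF that] frechet_derivative_at by (auto simp: differentiable_def)
  moreover from this have "C_k_on n S (\<lambda>x. frechet_derivative f (at x) v)" for v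
    by (intro C_k_on_cong[OF assms(1) _ assms(3)]) simp
  ultimately show ?thesis by simp
qed

lemma C_k_on_Suc_derivative:
  assumes "C_k_on (Suc n) S f" "x \<in> S"
  shows "(f has_derivative frechet_derivative f (at x)) (at x)"
  using assms frechet_derivative_works by auto

lemma C_k_on_Suc_D: "C_k_on (Suc n) S f \<Longrightarrow> C_k_on n S f"
proof (induction n arbitrary: f)
  case 0
  then show ?case
    by (auto intro!: continuous_at_imp_continuous_on differentiable_imp_continuous_within)
next
  case (Suc n)
  then show ?case by (metis C_k_on.simps(2))
qed

lemma C_k_on_subset: "C_k_on n S f \<Longrightarrow> T \<subseteq> S \<Longrightarrow> C_k_on n T f"
proof (induction n arbitrary: f)
  case 0 then show ?case by (auto intro: continuous_on_subset)
next
  case (Suc n) then show ?case by auto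
qed

lemma C_k_on_const: "C_k_on n S (\<lambda>x. c)"
  by (induction n arbitrary: c) auto

lemma C_k_on_bounded_linear:
  assumes "open S" "bounded_linear L" "C_k_on n S f"
  shows "C_k_on n S (\<lambda>x. L (f x))"
  using assms(3)
proof (induction n arbitrary: f)
  case 0
  then show ?case using bounded_linear.continuous_on[OF assms(2)] by simp
next
  case (Suc n)
  then show ?case
    by (intro C_k_on_SucI[OF assms(1) bounded_linear.has_derivative[OF assms(2) C_k_on_Suc_derivative]]
        Suc.IH) auto
qed

lemma C_k_on_add:
  assumes "open S" "C_k_on n S f" "C_k_on n S g"
  shows "C_k_on n S (\<lambda>x. f x + g x)"
  using assms(2,3)
proof (induction n arbitrary: f g)
  case 0
  then show ?case by (simp add: continuous_on_add)
next
  case (Suc n)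
  then show ?case
    by (intro C_k_on_SucI[OF assms(1) has_derivative_add[OF C_k_on_Suc_derivative C_k_on_Suc_derivative]]
        Suc.IH) auto
qed

lemma C_k_on_sum:
  assumes "open S" "\<And>i. i \<in> I \<Longrightarrow> C_k_on n S (f i)"
  shows "C_k_on n S (\<lambda>x. \<Sum>i\<in>I. f i x)"
  using assms(2) by (induction I rule: infinite_finite_induct)
    (auto intro: C_k_on_add[OF assms(1)] C_k_on_const)

text \<open>One induction with the Leibniz rule serves products, scalar multiples, inner products
  and later the Lorentz product.\<close>

lemma C_k_on_bilinear:
  assumes "open S" "bounded_bilinear B" "C_k_on n S f" "C_k_on n S g"
  shows "C_k_on n S (\<lambda>x. B (f x) (g x))"
  using assms(3,4)
proof (induction n arbitrary: f g)
  case 0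
  then show ?case using bounded_bilinear.continuous_on[OF assms(2)] by simp
next
  case (Suc n)
  show ?case
  proof (rule C_k_on_SucI[OF assms(1), where f' = "\<lambda>x v. B (f x) (frechet_derivative g (at x) v)
      + B (frechet_derivative f (at x) v) (g x)"])
    show "((\<lambda>x. B (f x) (g x)) has_derivative
        (\<lambda>v. B (f x) (frechet_derivative g (at x) v) + B (frechet_derivative f (at x) v) (g x))) (at x)"
      if "x \<in> S" for x
      using Suc.prems that by (intro bounded_bilinear.FDERIV[OF assms(2)] C_k_on_Suc_derivative)
  next
    show "C_k_on n S (\<lambda>x. B (f x) (frechet_derivative g (at x) v) + B (frechet_derivative f (at x) v) (g x))"
      for v
      using Suc.prems C_k_on_Suc_D[OF Suc.prems(1)] C_k_on_Suc_D[OF Suc.prems(2)]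
      by (intro C_k_on_add[OF assms(1)] Suc.IH) auto
  qed
qed

lemmas C_k_on_mult = C_k_on_bilinear[OF _ bounded_bilinear_mult]
lemmas C_k_on_scaleR = C_k_on_bilinear[OF _ bounded_bilinear_scaleR]
lemmas C_k_on_inner = C_k_on_bilinear[OF _ bounded_bilinear_inner]

lemma C_k_on_prod:
  fixes f :: "'i \<Rightarrow> 'v::real_normed_vector \<Rightarrow> real"
  assumes "open S" "\<And>i. i \<in> I \<Longrightarrow> C_k_on n S (f i)"
  shows "C_k_on n S (\<lambda>x. \<Prod>i\<in>I. f i x)"
  using assms(2) by (induction I rule: infinite_finite_induct)
    (auto intro: C_k_on_mult[OF assms(1)] C_k_on_const)

lemma C_k_on_inverse:
  fixes f :: "'v::real_normed_vector \<Rightarrow> real"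
  assumes "open S" "C_k_on n S f" "\<And>x. x \<in> S \<Longrightarrow> f x \<noteq> 0"
  shows "C_k_on n S (\<lambda>x. inverse (f x))"
  using assms(2)
proof (induction n)
  case 0
  then show ?case using assms(3) by (auto intro: continuous_on_inverse)
next
  case (Suc n)
  have "C_k_on n S (\<lambda>x. (- 1) * (inverse (f x) * frechet_derivative f (at x) v * inverse (f x)))" for v
    using Suc.prems Suc.IH[OF C_k_on_Suc_D[OF Suc.prems]]
    by (intro C_k_on_mult[OF assms(1)] C_k_on_const) auto
  then show ?case
    using Suc.prems assms(3)
    by (intro C_k_on_SucI[OF assms(1) Deriv.has_derivative_inverse[OF _ C_k_on_Suc_derivative]]) auto
qed

lemma C_k_on_divide:
  fixes f g :: "'v::real_normed_vector \<Rightarrow> real"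
  assumes "open S" "C_k_on n S f" "C_k_on n S g" "\<And>x. x \<in> S \<Longrightarrow> g x \<noteq> 0"
  shows "C_k_on n S (\<lambda>x. f x / g x)"
  using assms by (simp add: divide_inverse C_k_on_mult C_k_on_inverse)

lemma linear_Basis_expand:
  fixes L :: "'v::euclidean_space \<Rightarrow> 'w::real_vector"
  assumes "linear L"
  shows "L v = (\<Sum>b\<in>Basis. (v \<bullet> b) *\<^sub>R L b)"
  using assms by (subst euclidean_representation[of v, symmetric])
    (simp add: linear_sum linear_scale del: euclidean_representation)

text \<open>\<open>C_k_on\<close> controls derivatives in constant directions only, whereas the
  chain rule differentiates \<open>f\<close> in a direction that moves with the point. Expanding
  that direction in a basis restores constant directions, with smooth coefficients.\<close>

lemma C_k_on_compose:
  fixes u :: "'u::real_normed_vector \<Rightarrow> 'v::euclidean_space"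
    and f :: "'v \<Rightarrow> 'w::real_normed_vector"
  assumes "open S" "u ` S \<subseteq> T" "C_k_on n S u" "C_k_on n T f"
  shows "C_k_on n S (\<lambda>x. f (u x))"
  using assms(3,4)
proof (induction n arbitrary: f)
  case 0
  then show ?case using continuous_on_compose2[of T f S u] assms(2) by simp
next
  case (Suc n)
  let ?D = "\<lambda>x v. frechet_derivative f (at (u x)) (frechet_derivative u (at x) v)"
  have eq: "?D x v = (\<Sum>b\<in>Basis. (frechet_derivative u (at x) v \<bullet> b) *\<^sub>R frechet_derivative f (at (u x)) b)"
    if "x \<in> S" for x v
    using Suc.prems(2) that assms(2) by (intro linear_Basis_expand linear_frechet_derivative) auto
  show ?case
  proof (rule C_k_on_SucI[OF assms(1)])
    show "((\<lambda>x. f (u x)) has_derivative ?D x) (at x)" if "x \<in> S" for x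
      using C_k_on_Suc_derivative[OF Suc.prems(1) that]
        C_k_on_Suc_derivative[OF Suc.prems(2), of "u x"] that assms(2)
      by (auto intro!: has_derivative_compose[of u _ x UNIV f])
    have "C_k_on n S (\<lambda>x. \<Sum>b\<in>Basis. (frechet_derivative u (at x) v \<bullet> b) *\<^sub>R frechet_derivative f (at (u x)) b)"
      for v
      using Suc.prems C_k_on_Suc_D[OF Suc.prems(1)]
      by (intro C_k_on_sum[OF assms(1)] C_k_on_scaleR[OF assms(1)] Suc.IH C_k_on_inner[OF assms(1)]
          C_k_on_const) auto
    then show "C_k_on n S (\<lambda>x. ?D x v)" for v
      by (rule C_k_on_cong[OF assms(1), rotated]) (simp add: eq)
  qed
qed

lemma C_k_on_vec:
  fixes f :: "'v::real_normed_vector \<Rightarrow> real^'m::finite"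
  assumes "open S" "\<And>i. C_k_on n S (\<lambda>x. f x $ i)"
  shows "C_k_on n S f"
proof -
  have "C_k_on n S (\<lambda>x. \<Sum>i\<in>UNIV. f x $ i *\<^sub>R (axis i 1 :: real^'m))"
    using assms by (intro C_k_on_sum C_k_on_scaleR C_k_on_const) auto
  then show ?thesis
    using basis_expansion[of "f x" for x] by (simp add: scalar_mult_eq_scaleR)
qed

section \<open>Differentiability of determinants and inverse matrices\<close>

lemma C_k_on_det:
  fixes A :: "'v::real_normed_vector \<Rightarrow> real^'m^'m::finite"
  assumes "open S" "\<And>i j. C_k_on n S (\<lambda>x. A x $ i $ j)"
  shows "C_k_on n S (\<lambda>x. det (A x))"
  unfolding det_def
  using assms by (intro C_k_on_sum C_k_on_mult C_k_on_const C_k_on_prod) auto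

lemma matrix_inv_works:
  fixes A :: "real^'m^'m::finite"
  assumes "det A \<noteq> 0"
  shows "A ** matrix_inv A = mat 1" "matrix_inv A ** A = mat 1"
proof -
  have "\<exists>B. A ** B = mat 1 \<and> B ** A = mat 1"
    using assms unfolding invertible_det_nz[symmetric] invertible_def .
  from someI_ex[OF this] show "A ** matrix_inv A = mat 1" "matrix_inv A ** A = mat 1"
    by (simp_all add: matrix_inv_def)
qed

text \<open>Cramer's rule: column \<open>l\<close> of the inverse solves a linear system. Entries
  become quotients of determinants, to which the closure rules apply.\<close>

lemma matrix_inv_entry:
  fixes A :: "real^'m^'m::finite"
  assumes "det A \<noteq> 0"
  shows "matrix_inv A $ k $ l = det (\<chi> i j. if j = k then axis l 1 $ i else A $ i $ j) / det A"
proof -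
  have "A *v (matrix_inv A *v axis l 1) = axis l 1"
    using matrix_inv_works[OF assms] by (simp add: matrix_vector_mul_assoc)
  from cramer[OF assms, THEN iffD1, OF this] have "(matrix_inv A *v axis l 1) $ k =
      det (\<chi> i j. if j = k then axis l 1 $ i else A $ i $ j) / det A"
    by (simp only: vec_lambda_beta)
  then show ?thesis by (simp add: matrix_vector_mult_basis column_def)
qed

lemma C_k_on_matrix_inv:
  fixes A :: "'v::real_normed_vector \<Rightarrow> real^'m^'m::finite"
  assumes "open S" "\<And>i j. C_k_on n S (\<lambda>x. A x $ i $ j)" "\<And>x. x \<in> S \<Longrightarrow> det (A x) \<noteq> 0"
  shows "C_k_on n S (\<lambda>x. matrix_inv (A x) $ k $ l)"
proof (rule C_k_on_cong[OF assms(1)])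
  show "C_k_on n S (\<lambda>x. det (\<chi> i j. if j = k then axis l 1 $ i else A x $ i $ j) / det (A x))"
  proof (intro C_k_on_divide C_k_on_det assms)
    show "C_k_on n S (\<lambda>x. (\<chi> i j. if j = k then axis l 1 $ i else A x $ i $ j) $ i $ j)" for i j
      using assms(2) C_k_on_const by (cases "j = k") auto
  qed
qed (simp add: matrix_inv_entry assms(3))

section \<open>Second derivatives\<close>

lemma smooth_on_D: "smooth_on S f \<Longrightarrow> C_k_on n S f"
  by (simp add: smooth_on_def)

lemma smooth_on_has_derivative:
  "smooth_on S f \<Longrightarrow> x \<in> S \<Longrightarrow> (f has_derivative frechet_derivative f (at x)) (at x)"
  by (rule C_k_on_Suc_derivative[OF smooth_on_D[where n = "Suc 0"]])

lemma smooth_on_linear: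
  "smooth_on S f \<Longrightarrow> x \<in> S \<Longrightarrow> linear (frechet_derivative f (at x))"
  using smooth_on_has_derivative has_derivative_linear by blast

lemma smooth_on_frechet_derivative:
  "smooth_on S f \<Longrightarrow> smooth_on S (\<lambda>x. frechet_derivative f (at x) v)"
  unfolding smooth_on_def by (metis C_k_on.simps(2))

lemma smooth_on_subset: "smooth_on S f \<Longrightarrow> T \<subseteq> S \<Longrightarrow> smooth_on T f"
  unfolding smooth_on_def using C_k_on_subset by blast

lemma smooth_on_cong:
  "open S \<Longrightarrow> (\<And>x. x \<in> S \<Longrightarrow> f x = g x) \<Longrightarrow> smooth_on S f \<Longrightarrow> smooth_on S g"
  unfolding smooth_on_def using C_k_on_cong by blast

lemma smooth_on_bounded_linear:
  "open S \<Longrightarrow> bounded_linear L \<Longrightarrow> smooth_on S f \<Longrightarrow> smooth_on S (\<lambda>x. L (f x))"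
  unfolding smooth_on_def using C_k_on_bounded_linear by blast

lemma smooth_on_continuous: "smooth_on S f \<Longrightarrow> continuous_on S f"
  using smooth_on_D[where n = 0] by simp

text \<open>The direction \<open>w\<close> belongs to the outer derivative, so the indices appear
  reversed when compared with iterated partial derivatives; see
  \<open>second_derivative_axis\<close>.\<close>

definition second_derivative ::
    "('v::real_normed_vector \<Rightarrow> 'w::real_normed_vector) \<Rightarrow> 'v \<Rightarrow> 'v \<Rightarrow> 'v \<Rightarrow> 'w" where
  "second_derivative f x v w = frechet_derivative (\<lambda>z. frechet_derivative f (at z) v) (at x) w"

lemma has_second_derivative:
  "smooth_on S f \<Longrightarrow> x \<in> S \<Longrightarrow>
    ((\<lambda>z. frechet_derivative f (at z) v) has_derivative second_derivative f x v) (at x)"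
  using smooth_on_has_derivative[OF smooth_on_frechet_derivative]
  by (simp add: second_derivative_def[abs_def])

lemma second_derivative_eqI:
  assumes "open S" "x \<in> S" "\<And>z. z \<in> S \<Longrightarrow> (f has_derivative f' z) (at z)"
    and "((\<lambda>z. f' z v) has_derivative D) (at x)"
  shows "second_derivative f x v w = D w"
proof -
  have "f' z = frechet_derivative f (at z)" if "z \<in> S" for z
    using assms(3)[OF that] frechet_derivative_at by blast
  then have "((\<lambda>z. frechet_derivative f (at z) v) has_derivative D) (at x)"
    by (intro has_derivative_transform_within_open[OF assms(4,1,2)]) simp
  then show ?thesis
    unfolding second_derivative_def by (metis frechet_derivative_at)
qed

text \<open>In the outer direction this is linearity of a derivative. In the inner direction,
  linearity of \<open>frechet_derivative\<close> holds at all points of \<open>S\<close> and may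
  therefore be differentiated.\<close>

lemma linear_second_derivative:
  assumes "open S" "smooth_on S f" "x \<in> S"
  shows "linear (second_derivative f x v)" "linear (\<lambda>v. second_derivative f x v w)"
proof -
  show "linear (second_derivative f x v)"
    using has_second_derivative[OF assms(2,3)] has_derivative_linear by blast
  note d = smooth_on_has_derivative[OF assms(2)]
  show "linear (\<lambda>v. second_derivative f x v w)"
  proof (rule linearI)
    fix a b c
    have "((\<lambda>z. frechet_derivative f (at z) (a + b)) has_derivative
        (\<lambda>w. second_derivative f x a w + second_derivative f x b w)) (at x)"
      by (rule has_derivative_transform_within_open
          [OF has_derivative_add[OF has_second_derivative has_second_derivative, OF assms(2,3,2,3)] assms(1,3)])
        (simp add: linear_add[OF smooth_on_linear[OF assms(2)]])
    from second_derivative_eqI[OF assms(1,3) d this]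
    show "second_derivative f x (a + b) w = second_derivative f x a w + second_derivative f x b w" .
    have "((\<lambda>z. frechet_derivative f (at z) (c *\<^sub>R a)) has_derivative
        (\<lambda>w. c *\<^sub>R second_derivative f x a w)) (at x)"
      by (rule has_derivative_transform_within_open
          [OF has_derivative_scaleR_right[OF has_second_derivative[OF assms(2,3)]] assms(1,3)])
        (simp add: linear_scale[OF smooth_on_linear[OF assms(2)]])
    from second_derivative_eqI[OF assms(1,3) d this]
    show "second_derivative f x (c *\<^sub>R a) w = c *\<^sub>R second_derivative f x a w" .
  qed
qed

lemma second_derivative_bounded_linear:
  assumes "open S" "smooth_on S f" "x \<in> S" "bounded_linear L"
  shows "second_derivative (\<lambda>z. L (f z)) x v w = L (second_derivative f x v w)"
proof (rule second_derivative_eqI[OF assms(1,3)])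
  show "((\<lambda>z. L (f z)) has_derivative (\<lambda>v. L (frechet_derivative f (at z) v))) (at z)" if "z \<in> S" for z
    by (rule bounded_linear.has_derivative[OF assms(4) smooth_on_has_derivative[OF assms(2) that]])
  show "((\<lambda>z. L (frechet_derivative f (at z) v)) has_derivative (\<lambda>w. L (second_derivative f x v w))) (at x)"
    by (rule bounded_linear.has_derivative[OF assms(4) has_second_derivative[OF assms(2,3)]])
qed

lemma frechet_derivative_bounded_linear:
  assumes "smooth_on S f" "x \<in> S" "bounded_linear L"
  shows "frechet_derivative (\<lambda>z. L (f z)) (at x) v = L (frechet_derivative f (at x) v)"
  using bounded_linear.has_derivative[OF assms(3) smooth_on_has_derivative[OF assms(1,2)]]
  by (metis frechet_derivative_at)

lemma frechet_derivative_compose_smooth: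
  assumes "smooth_on S u" "smooth_on T f" "x \<in> S" "u x \<in> T"
  shows "frechet_derivative (\<lambda>z. f (u z)) (at x) v =
    frechet_derivative f (at (u x)) (frechet_derivative u (at x) v)"
  using has_derivative_compose[of u _ x UNIV f, OF smooth_on_has_derivative[OF assms(1,3)]]
    smooth_on_has_derivative[OF assms(2,4)] by (metis frechet_derivative_at)

text \<open>The last summand lies in the range of the differential of \<open>f\<close>. It is the
  whole reason why Hessian traces depend on the chart, and why they do so only up to tangent
  vectors.\<close>

lemma second_derivative_compose:
  fixes u :: "'u::real_normed_vector \<Rightarrow> 'v::euclidean_space"
    and f :: "'v \<Rightarrow> 'w::real_normed_vector"
  assumes S: "open S" "smooth_on S u" and T: "open T" "smooth_on T f"
    and sub: "u ` S \<subseteq> T" and x: "x \<in> S"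
  shows "second_derivative (\<lambda>z. f (u z)) x v w =
    second_derivative f (u x) (frechet_derivative u (at x) v) (frechet_derivative u (at x) w)
    + frechet_derivative f (at (u x)) (second_derivative u x v w)"
proof -
  let ?u = "\<lambda>z. frechet_derivative u (at z)" and ?f = "\<lambda>z. frechet_derivative f (at z)"
  have ux: "u z \<in> T" if "z \<in> S" for z using sub that by auto
  have 1: "((\<lambda>z. f (u z)) has_derivative (\<lambda>v. ?f (u z) (?u z v))) (at z)" if "z \<in> S" for z
    using has_derivative_compose[OF smooth_on_has_derivative[OF S(2) that]
        smooth_on_has_derivative[OF T(2) ux[OF that]]] .
  have eq: "?f (u z) (?u z v) = (\<Sum>b\<in>Basis. (?u z v \<bullet> b) *\<^sub>R ?f (u z) b)" if "z \<in> S" for z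
    by (rule linear_Basis_expand[OF smooth_on_linear[OF T(2) ux[OF that]]])
  have "((\<lambda>z. \<Sum>b\<in>Basis. (?u z v \<bullet> b) *\<^sub>R ?f (u z) b) has_derivative
      (\<lambda>w. \<Sum>b\<in>Basis. (?u x v \<bullet> b) *\<^sub>R second_derivative f (u x) b (?u x w)
        + (second_derivative u x v w \<bullet> b) *\<^sub>R ?f (u x) b)) (at x)"
    by (intro has_derivative_sum bounded_bilinear.FDERIV[OF bounded_bilinear_scaleR]
        has_derivative_inner_left has_second_derivative[OF S(2) x]
        has_derivative_compose[OF smooth_on_has_derivative[OF S(2) x]
          has_second_derivative[OF T(2) ux[OF x]]])
  then have "((\<lambda>z. ?f (u z) (?u z v)) has_derivative
      (\<lambda>w. \<Sum>b\<in>Basis. (?u x v \<bullet> b) *\<^sub>R second_derivative f (u x) b (?u x w)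
        + (second_derivative u x v w \<bullet> b) *\<^sub>R ?f (u x) b)) (at x)"
    by (rule has_derivative_transform_within_open[OF _ S(1) x]) (simp add: eq)
  from second_derivative_eqI[OF S(1) x 1 this]
  have "second_derivative (\<lambda>z. f (u z)) x v w =
      (\<Sum>b\<in>Basis. (?u x v \<bullet> b) *\<^sub>R second_derivative f (u x) b (?u x w))
      + (\<Sum>b\<in>Basis. (second_derivative u x v w \<bullet> b) *\<^sub>R ?f (u x) b)"
    by (simp add: sum.distrib)
  moreover have "second_derivative f (u x) (?u x v) (?u x w) =
      (\<Sum>b\<in>Basis. (?u x v \<bullet> b) *\<^sub>R second_derivative f (u x) b (?u x w))"
    using linear_Basis_expand[OF linear_second_derivative(2)[OF T ux[OF x]], of "?u x v" "?u x w"] .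
  moreover have "?f (u x) (second_derivative u x v w) =
      (\<Sum>b\<in>Basis. (second_derivative u x v w \<bullet> b) *\<^sub>R ?f (u x) b)"
    by (rule linear_Basis_expand[OF smooth_on_linear[OF T(2) ux[OF x]]])
  ultimately show ?thesis by simp
qed

section \<open>Symmetry of second derivatives\<close>

lemma has_real_derivative_along_line:
  fixes f :: "'v::real_normed_vector \<Rightarrow> real"
  assumes "(f has_derivative f') (at (c + s *\<^sub>R v))"
  shows "((\<lambda>s. f (c + s *\<^sub>R v)) has_real_derivative f' v) (at s)"
proof -
  have "((\<lambda>s. c + s *\<^sub>R v) has_derivative (\<lambda>h. h *\<^sub>R v)) (at s)"
    by (auto intro!: derivative_eq_intros)
  from has_derivative_compose[OF this assms]
  show ?thesis
    using has_derivative_linear[OF assms]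
    by (simp add: has_field_derivative_def linear_scale mult_commute_abs)
qed

text \<open>Two applications of the mean value theorem: to the difference of \<open>f\<close> along
  the two sides parallel to \<open>v\<close>, then to the derivative in direction \<open>v\<close>
  along a segment parallel to \<open>w\<close>.\<close>

lemma mixed_difference_mvt:
  fixes f :: "'v::real_normed_vector \<Rightarrow> real"
  assumes "smooth_on S f" "h > 0"
    and "\<And>s t. 0 \<le> s \<Longrightarrow> s \<le> h \<Longrightarrow> 0 \<le> t \<Longrightarrow> t \<le> h \<Longrightarrow> x + s *\<^sub>R v + t *\<^sub>R w \<in> S"
  obtains s t where "0 < s" "s < h" "0 < t" "t < h"
    "f (x + h *\<^sub>R v + h *\<^sub>R w) - f (x + h *\<^sub>R v) - f (x + h *\<^sub>R w) + f x
      = h * h * second_derivative f (x + s *\<^sub>R v + t *\<^sub>R w) v w"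
proof -
  let ?d = "\<lambda>z. frechet_derivative f (at z) v"
  have 1: "((\<lambda>s. f (x + t *\<^sub>R w + s *\<^sub>R v)) has_real_derivative ?d (x + t *\<^sub>R w + s *\<^sub>R v)) (at s)"
    if "0 \<le> s" "s \<le> h" "0 \<le> t" "t \<le> h" for s t
    using assms(3)[OF that] by (intro has_real_derivative_along_line smooth_on_has_derivative[OF assms(1)])
      (simp add: algebra_simps)
  have "((\<lambda>s. f (x + h *\<^sub>R w + s *\<^sub>R v) - f (x + s *\<^sub>R v)) has_real_derivative
      ?d (x + h *\<^sub>R w + s *\<^sub>R v) - ?d (x + s *\<^sub>R v)) (at s)" if "0 \<le> s" "s \<le> h" for s
    using DERIV_diff[OF 1[OF that, of h] 1[OF that, of 0]] \<open>h > 0\<close> by simp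
  from MVT2[OF \<open>h > 0\<close> this] obtain s where s: "0 < s" "s < h"
    and eq1: "f (x + h *\<^sub>R w + h *\<^sub>R v) - f (x + h *\<^sub>R v) - (f (x + h *\<^sub>R w) - f x)
      = h * (?d (x + h *\<^sub>R w + s *\<^sub>R v) - ?d (x + s *\<^sub>R v))"
    by auto
  have "((\<lambda>t. ?d (x + s *\<^sub>R v + t *\<^sub>R w)) has_real_derivative
      second_derivative f (x + s *\<^sub>R v + t *\<^sub>R w) v w) (at t)" if "0 \<le> t" "t \<le> h" for t
    using s that by (intro has_real_derivative_along_line[where f' = "second_derivative f (x + s *\<^sub>R v + t *\<^sub>R w) v"]
        has_second_derivative[OF assms(1) assms(3)]) auto
  from MVT2[OF \<open>h > 0\<close> this] obtain t where t: "0 < t" "t < h"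
    and eq2: "?d (x + s *\<^sub>R v + h *\<^sub>R w) - ?d (x + s *\<^sub>R v)
      = h * second_derivative f (x + s *\<^sub>R v + t *\<^sub>R w) v w"
    by auto
  show thesis
    using eq1 eq2 by (intro that[OF s t]) (simp add: algebra_simps)
qed

text \<open>The mixed difference over a small parallelogram is symmetric in \<open>v\<close> and
  \<open>w\<close>, so a value of one mixed derivative near \<open>x\<close> equals a value of the
  other near \<open>x\<close>. Continuity at \<open>x\<close> does the rest.\<close>

lemma second_derivative_symmetric_real:
  fixes f :: "'v::real_normed_vector \<Rightarrow> real"
  assumes "open S" "smooth_on S f" "x \<in> S"
  shows "second_derivative f x v w = second_derivative f x w v"
proof -
  have cont: "isCont (\<lambda>z. second_derivative f z a b) x" for a b
    using smooth_on_continuous[OF smooth_on_frechet_derivative[OF smooth_on_frechet_derivative[OF assms(2), of a], of b]]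
      assms by (simp add: second_derivative_def[abs_def] continuous_on_eq_continuous_at)
  have "\<bar>second_derivative f x v w - second_derivative f x w v\<bar> \<le> 0 + e" if "e > 0" for e
  proof -
    have ev: "\<forall>\<^sub>F z in nhds x. dist (second_derivative f z a b) (second_derivative f x a b) < e / 2" for a b
    proof (rule tendstoD)
      show "((\<lambda>z. second_derivative f z a b) \<longlongrightarrow> second_derivative f x a b) (nhds x)"
        using cont[of a b] unfolding isCont_def tendsto_at_iff_tendsto_nhds[of "\<lambda>z. second_derivative f z a b" x] .
    qed (use \<open>e > 0\<close> in simp)
    have "\<forall>\<^sub>F z in nhds x. z \<in> S" using assms by (intro eventually_nhds_in_open)
    with ev[of v w] ev[of w v]
    have "\<forall>\<^sub>F z in nhds x. z \<in> S \<and> dist (second_derivative f z v w) (second_derivative f x v w) < e / 2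
        \<and> dist (second_derivative f z w v) (second_derivative f x w v) < e / 2"
      by eventually_elim auto
    then obtain d where d: "d > 0" and near: "\<And>z. dist z x < d \<Longrightarrow> z \<in> S
        \<and> dist (second_derivative f z v w) (second_derivative f x v w) < e / 2
        \<and> dist (second_derivative f z w v) (second_derivative f x w v) < e / 2"
      unfolding eventually_nhds_metric by blast
    \<comment> \<open>Small enough that the whole parallelogram spanned by \<open>h\<close> times
      \<open>v\<close> and \<open>w\<close> stays within distance \<open>d\<close> of
      \<open>x\<close>; the summand 1 covers vanishing \<open>v\<close> and
      \<open>w\<close>.\<close>
    define h where "h = d / (norm v + norm w + 1)"
    have pos: "norm v + norm w + 1 > 0" by (smt (verit) norm_ge_zero)
    then have h: "h > 0" using d by (simp add: h_def)
    have close: "dist (x + s *\<^sub>R a + t *\<^sub>R b) x < d"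
      if "0 \<le> s" "s \<le> h" "0 \<le> t" "t \<le> h" "{a, b} = {v, w}" for s t a b
    proof -
      have "dist (x + s *\<^sub>R a + t *\<^sub>R b) x \<le> s * norm a + t * norm b"
        using that norm_triangle_ineq[of "s *\<^sub>R a" "t *\<^sub>R b"] by (simp add: dist_norm add.assoc)
      also have "\<dots> \<le> h * norm a + h * norm b"
        using that by (intro add_mono mult_right_mono) auto
      also have "\<dots> = h * (norm v + norm w)"
        using that(5) by (auto simp: doubleton_eq_iff algebra_simps)
      also have "\<dots> < h * (norm v + norm w + 1)" using h by simp
      also have "\<dots> = d" using pos by (simp add: h_def)
      finally show ?thesis .
    qed
    obtain s t where st: "0 < s" "s < h" "0 < t" "t < h"
      "f (x + h *\<^sub>R v + h *\<^sub>R w) - f (x + h *\<^sub>R v) - f (x + h *\<^sub>R w) + f x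
        = h * h * second_derivative f (x + s *\<^sub>R v + t *\<^sub>R w) v w"
      by (rule mixed_difference_mvt[OF assms(2) h, of x v w]) (auto intro!: near[THEN conjunct1] close)
    obtain s' t' where st': "0 < s'" "s' < h" "0 < t'" "t' < h"
      "f (x + h *\<^sub>R w + h *\<^sub>R v) - f (x + h *\<^sub>R w) - f (x + h *\<^sub>R v) + f x
        = h * h * second_derivative f (x + s' *\<^sub>R w + t' *\<^sub>R v) w v"
      by (rule mixed_difference_mvt[OF assms(2) h, of x w v])
        (auto intro!: near[THEN conjunct1] close simp: insert_commute)
    have "h * h * second_derivative f (x + s *\<^sub>R v + t *\<^sub>R w) v w
        = h * h * second_derivative f (x + s' *\<^sub>R w + t' *\<^sub>R v) w v"
      using st(5) st'(5) by (simp add: algebra_simps)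
    then have "second_derivative f (x + s *\<^sub>R v + t *\<^sub>R w) v w
        = second_derivative f (x + s' *\<^sub>R w + t' *\<^sub>R v) w v" using h by simp
    moreover have "\<bar>second_derivative f (x + s *\<^sub>R v + t *\<^sub>R w) v w - second_derivative f x v w\<bar> < e / 2"
      using near[OF close[of s t v w]] st by (simp add: dist_real_def)
    moreover have "\<bar>second_derivative f (x + s' *\<^sub>R w + t' *\<^sub>R v) w v - second_derivative f x w v\<bar> < e / 2"
      using near[OF close[of s' t' w v]] st' by (simp add: dist_real_def insert_commute)
    ultimately show ?thesis by linarith
  qed
  then have "\<bar>second_derivative f x v w - second_derivative f x w v\<bar> \<le> 0"
    by (rule field_le_epsilon)
  then show ?thesis by simp
qed

lemma second_derivative_symmetric:
  fixes f :: "'v::real_normed_vector \<Rightarrow> 'w::euclidean_space"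
  assumes "open S" "smooth_on S f" "x \<in> S"
  shows "second_derivative f x v w = second_derivative f x w v"
proof (rule euclidean_eqI)
  fix b :: 'w
  have "second_derivative (\<lambda>z. f z \<bullet> b) x v w = second_derivative (\<lambda>z. f z \<bullet> b) x w v"
    by (intro second_derivative_symmetric_real[OF assms(1) _ assms(3)]
        smooth_on_bounded_linear[OF assms(1) bounded_linear_inner_left assms(2)])
  then show "second_derivative f x v w \<bullet> b = second_derivative f x w v \<bullet> b"
    by (simp add: second_derivative_bounded_linear[OF assms bounded_linear_inner_left])
qed

section \<open>Immersions with nondegenerate induced metric\<close>

definition lorentz_product :: "'m::finite minkowski_space \<Rightarrow> 'm minkowski_space \<Rightarrow> real" where
  "lorentz_product v w = - (fst v * fst w) + snd v \<bullet> snd w"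

lemma minkowski_eq: "minkowski p v w = lorentz_product v w"
  by (simp add: minkowski_def lorentz_product_def inner_vec_def)

lemma bounded_bilinear_lorentz_product: "bounded_bilinear (lorentz_product :: 'm::finite minkowski_space \<Rightarrow> _)"
proof -
  have eq: "lorentz_product = (\<lambda>v w :: 'm minkowski_space. v \<bullet> (- fst w, snd w))"
    by (simp add: lorentz_product_def inner_prod_def fun_eq_iff)
  have "bounded_linear (\<lambda>w :: 'm minkowski_space. (- fst w, snd w))"
    by (intro bounded_linear_Pair bounded_linear_minus bounded_linear_fst bounded_linear_snd)
  then show ?thesis
    unfolding eq by (rule bounded_bilinear.comp[OF bounded_bilinear_inner bounded_linear_ident])
qed

interpretation lorentz: bounded_bilinear lorentz_product
  by (rule bounded_bilinear_lorentz_product)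

lemma lorentz_product_commute: "lorentz_product v w = lorentz_product w v"
  by (simp add: lorentz_product_def inner_commute mult.commute)

lemma lorentz_product_nondegenerate:
  assumes "\<And>w. lorentz_product v w = 0"
  shows "v = 0"
proof -
  have "v \<bullet> v = 0" using assms[of "(- fst v, snd v)"] by (simp add: lorentz_product_def inner_prod_def)
  then show ?thesis by simp
qed

lemma linear_axis_expand:
  fixes L :: "real^'k::finite \<Rightarrow> 'w::real_vector"
  assumes "linear L"
  shows "L v = (\<Sum>i\<in>UNIV. v $ i *\<^sub>R L (axis i 1))"
  using assms basis_expansion[of v]
  by (metis (mono_tags, lifting) linear_scale linear_sum scalar_mult_eq_scaleR sum.cong)

lemma det_nonzeroI:
  fixes A :: "real^'k^'k::finite"
  assumes "\<And>v. A *v v = 0 \<Longrightarrow> v = 0"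
  shows "det A \<noteq> 0"
  using assms matrix_left_invertible_ker[of A] invertible_det_nz invertible_left_inverse by blast

lemma second_derivative_axis:
  "second_derivative f x (axis j 1) (axis i 1) = partial_deriv i (partial_deriv j f) x"
  by (simp add: second_derivative_def partial_deriv_def[abs_def])

lemma partial_deriv_eqI: "(f has_derivative D) (at x) \<Longrightarrow> partial_deriv i f x = D (axis i 1)"
  unfolding partial_deriv_def by (metis frechet_derivative_at)

lemma smooth_on_partial_deriv: "smooth_on S f \<Longrightarrow> smooth_on S (partial_deriv i f)"
  using smooth_on_frechet_derivative by (simp add: partial_deriv_def[abs_def])

lemma partial_deriv_has_derivative:
  "smooth_on S f \<Longrightarrow> x \<in> S \<Longrightarrow>
    (partial_deriv j f has_derivative second_derivative f x (axis j 1)) (at x)"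
  using has_second_derivative by (simp add: partial_deriv_def[abs_def])

text \<open>Only nondegeneracy of the induced metric is required, so that the locale covers spacelike
  immersions as well as parametrizations of the Lorentzian hypersurface.\<close>

locale nondegenerate_immersion =
  fixes S :: "(real^'k::finite) set" and \<psi> :: "real^'k \<Rightarrow> 'm::finite minkowski_space"
  assumes open_domain: "open S" and smooth: "smooth_on S \<psi>"
    and det_nonzero: "\<And>x. x \<in> S \<Longrightarrow> det (metric_matrix (pull_back minkowski \<psi>) x) \<noteq> 0"
begin

abbreviation "g \<equiv> pull_back minkowski \<psi>"
abbreviation "gmat \<equiv> metric_matrix g"
abbreviation "ginv \<equiv> inverse_metric g"
abbreviation "d i \<equiv> partial_deriv i \<psi>"
abbreviation "dd x i j \<equiv> second_derivative \<psi> x (axis i 1) (axis j 1)"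

lemma gmat_entry: "gmat x $ i $ j = lorentz_product (d i x) (d j x)"
  by (simp add: metric_matrix_def pull_back_def minkowski_eq partial_deriv_def)

lemma gmat_commute: "gmat x $ i $ j = gmat x $ j $ i"
  by (simp add: gmat_entry lorentz_product_commute)

lemma ginv_gmat: "x \<in> S \<Longrightarrow> (\<Sum>j\<in>UNIV. ginv x $ i $ j * gmat x $ j $ l) = (if i = l then 1 else 0)"
  using matrix_inv_works(2)[OF det_nonzero]
  by (simp add: inverse_metric_def matrix_matrix_mult_def mat_def vec_eq_iff)

lemma gmat_ginv: "x \<in> S \<Longrightarrow> (\<Sum>j\<in>UNIV. gmat x $ i $ j * ginv x $ j $ l) = (if i = l then 1 else 0)"
  using matrix_inv_works(1)[OF det_nonzero]
  by (simp add: inverse_metric_def matrix_matrix_mult_def mat_def vec_eq_iff)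

lemma linear_frechet: "x \<in> S \<Longrightarrow> linear (frechet_derivative \<psi> (at x))"
  using smooth smooth_on_linear by blast

lemma dd_commute: "x \<in> S \<Longrightarrow> dd x i j = dd x j i"
  by (rule second_derivative_symmetric[OF open_domain smooth])

lemma smooth_gmat: "smooth_on S (\<lambda>z. gmat z $ i $ j)"
  unfolding gmat_entry smooth_on_def
  by (intro allI C_k_on_bilinear[OF open_domain bounded_bilinear_lorentz_product]
      smooth_on_D smooth_on_partial_deriv smooth)

lemma smooth_ginv: "smooth_on S (\<lambda>z. ginv z $ i $ j)"
  unfolding inverse_metric_def smooth_on_def
  by (intro allI C_k_on_matrix_inv open_domain smooth_on_D[OF smooth_gmat] det_nonzero)

lemma partial_deriv_gmat:
  assumes "x \<in> S"
  shows "partial_deriv i (\<lambda>z. gmat z $ a $ b) x =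
    lorentz_product (d a x) (dd x b i) + lorentz_product (dd x a i) (d b x)"
  unfolding gmat_entry
  by (rule partial_deriv_eqI[OF lorentz.FDERIV[OF
          partial_deriv_has_derivative[OF smooth assms] partial_deriv_has_derivative[OF smooth assms]]])

text \<open>The metric is pulled back from a constant form, so its three derivatives give six
  products with second derivatives of \<open>\<psi>\<close>. Symmetry of these cancels four
  products, and the other two agree, which uses up the factor 1/2.\<close>

lemma christoffel_eq:
  assumes "x \<in> S"
  shows "christoffel g x c a b = (\<Sum>d'\<in>UNIV. ginv x $ c $ d' * lorentz_product (dd x a b) (d d' x))"
proof -
  have "partial_deriv a (\<lambda>z. gmat z $ b $ d') x + partial_deriv b (\<lambda>z. gmat z $ a $ d') x
      - partial_deriv d' (\<lambda>z. gmat z $ a $ b) x = 2 * lorentz_product (dd x a b) (d d' x)" for d'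
    unfolding partial_deriv_gmat[OF assms]
    using dd_commute[OF assms, of a b] dd_commute[OF assms, of a d'] dd_commute[OF assms, of b d']
      lorentz_product_commute[of "dd x d' a" "d b x"]
    by simp
  then show ?thesis
    unfolding christoffel_def by (simp add: sum_divide_distrib algebra_simps)
qed

text \<open>With the upper index lowered, the Christoffel symbols record exactly the tangential part
  of the second derivatives. This later identifies covariant differentiation in Q(r) with projected
  flat differentiation.\<close>

lemma christoffel_lower:
  assumes "x \<in> S"
  shows "(\<Sum>c\<in>UNIV. christoffel g x c a b * gmat x $ c $ e) = lorentz_product (dd x a b) (d e x)"
proof -
  have "(\<Sum>c\<in>UNIV. christoffel g x c a b * gmat x $ c $ e) =
      (\<Sum>c\<in>UNIV. \<Sum>f\<in>UNIV. ginv x $ c $ f * lorentz_product (dd x a b) (d f x) * gmat x $ c $ e)"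
    by (simp add: christoffel_eq[OF assms] sum_distrib_right)
  also have "\<dots> = (\<Sum>f\<in>UNIV. \<Sum>c\<in>UNIV. ginv x $ c $ f * lorentz_product (dd x a b) (d f x) * gmat x $ c $ e)"
    by (rule sum.swap)
  also have "\<dots> = (\<Sum>f\<in>UNIV. lorentz_product (dd x a b) (d f x) * (\<Sum>c\<in>UNIV. gmat x $ e $ c * ginv x $ c $ f))"
    by (simp add: sum_distrib_left gmat_commute[of x e] algebra_simps)
  also have "\<dots> = lorentz_product (dd x a b) (d e x)"
    by (simp add: gmat_ginv[OF assms] if_distrib sum.delta cong: if_cong)
  finally show ?thesis .
qed

text \<open>First-order coefficients of the Laplacian, in the form that the product rule delivers.
  Classically they are minus the trace of the Christoffel symbols over the two lower indices, which
  is what \<open>drift_lower\<close> amounts to. They do not involve the function to which the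
  Laplacian is applied, so one vector serves all components of \<open>\<psi>\<close>.\<close>

definition drift :: "real^'k \<Rightarrow> 'k \<Rightarrow> real" where
  "drift x j = (\<Sum>i\<in>UNIV. partial_deriv i (\<lambda>z. ginv z $ i $ j) x
      + (\<Sum>l\<in>UNIV. christoffel g x i i l * ginv x $ l $ j))"

lemma laplace_beltrami_eq:
  assumes "smooth_on S f" "x \<in> S"
  shows "laplace_beltrami g f x =
    (\<Sum>i\<in>UNIV. \<Sum>j\<in>UNIV. ginv x $ i $ j * second_derivative f x (axis j 1) (axis i 1))
    + (\<Sum>j\<in>UNIV. drift x j * partial_deriv j f x)"
proof -
  have 1: "partial_deriv i (\<lambda>z. gradient g f z $ i) x =
      (\<Sum>j\<in>UNIV. ginv x $ i $ j * second_derivative f x (axis j 1) (axis i 1)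
        + partial_deriv i (\<lambda>z. ginv z $ i $ j) x * partial_deriv j f x)" for i
  proof -
    have "((\<lambda>z. \<Sum>j\<in>UNIV. ginv z $ i $ j * partial_deriv j f z) has_derivative
        (\<lambda>v. \<Sum>j\<in>UNIV. ginv x $ i $ j * second_derivative f x (axis j 1) v
          + frechet_derivative (\<lambda>z. ginv z $ i $ j) (at x) v * partial_deriv j f x)) (at x)"
      by (intro has_derivative_sum has_derivative_mult partial_deriv_has_derivative[OF assms]
          smooth_on_has_derivative[OF smooth_ginv assms(2)])
    then show ?thesis
      by (simp add: gradient_def partial_deriv_eqI) (simp add: partial_deriv_def)
  qed
  have 2: "(\<Sum>l\<in>UNIV. christoffel g x i i l * gradient g f x $ l) =
      (\<Sum>j\<in>UNIV. (\<Sum>l\<in>UNIV. christoffel g x i i l * ginv x $ l $ j) * partial_deriv j f x)" for i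
    by (simp add: gradient_def sum_distrib_left sum_distrib_right mult.assoc) (rule sum.swap)
  show ?thesis
    unfolding laplace_beltrami_def divergence_def 1 2 drift_def
    by (simp add: sum.distrib sum_distrib_right ring_distribs)
      (simp add: sum.swap[of "\<lambda>i j. partial_deriv i (\<lambda>z. ginv z $ i $ j) x * partial_deriv j f x"]
        sum.swap[of "\<lambda>i j. \<Sum>l\<in>UNIV. christoffel g x i i l * ginv x $ l $ j * partial_deriv j f x"])
qed

text \<open>Differentiating the identity between \<open>ginv\<close> and \<open>gmat\<close> trades
  derivatives of \<open>ginv\<close> for derivatives of \<open>gmat\<close>. Half of the resulting
  terms are minus the contracted Christoffel symbols (\<open>inv\<close> against
  \<open>chr\<close>), and the other half is the claim. It makes the drift cancel the tangential
  part of the Hessian trace.\<close>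

lemma drift_lower:
  assumes "x \<in> S"
  shows "(\<Sum>j\<in>UNIV. drift x j * gmat x $ j $ e) =
    - (\<Sum>i\<in>UNIV. \<Sum>j\<in>UNIV. ginv x $ i $ j * lorentz_product (dd x j i) (d e x))"
proof -
  have inv: "(\<Sum>j\<in>UNIV. partial_deriv i (\<lambda>z. ginv z $ i $ j) x * gmat x $ j $ e) =
      - (\<Sum>j\<in>UNIV. ginv x $ i $ j * (lorentz_product (d j x) (dd x e i) + lorentz_product (dd x j i) (d e x)))" for i
  proof -
    have "((\<lambda>z. \<Sum>j\<in>UNIV. ginv z $ i $ j * gmat z $ j $ e) has_derivative
        (\<lambda>v. \<Sum>j\<in>UNIV. ginv x $ i $ j * frechet_derivative (\<lambda>z. gmat z $ j $ e) (at x) v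
          + frechet_derivative (\<lambda>z. ginv z $ i $ j) (at x) v * gmat x $ j $ e)) (at x)"
      by (intro has_derivative_sum has_derivative_mult
          smooth_on_has_derivative[OF smooth_ginv assms] smooth_on_has_derivative[OF smooth_gmat assms])
    moreover have "((\<lambda>z. \<Sum>j\<in>UNIV. ginv z $ i $ j * gmat z $ j $ e) has_derivative (\<lambda>v. 0)) (at x)"
      by (rule has_derivative_transform_within_open[OF has_derivative_const open_domain assms])
        (simp add: ginv_gmat)
    ultimately have "(\<Sum>j\<in>UNIV. ginv x $ i $ j * partial_deriv i (\<lambda>z. gmat z $ j $ e) x
          + partial_deriv i (\<lambda>z. ginv z $ i $ j) x * gmat x $ j $ e) = 0"
      unfolding partial_deriv_def by (rule has_derivative_unique[THEN fun_cong, of _ _ x _ "axis i 1"])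
    then show ?thesis
      unfolding partial_deriv_gmat[OF assms] by (simp add: sum.distrib)
  qed
  have chr: "(\<Sum>j\<in>UNIV. (\<Sum>l\<in>UNIV. christoffel g x i i l * ginv x $ l $ j) * gmat x $ j $ e) =
      christoffel g x i i e" for i
  proof -
    have "(\<Sum>j\<in>UNIV. (\<Sum>l\<in>UNIV. christoffel g x i i l * ginv x $ l $ j) * gmat x $ j $ e) =
        (\<Sum>l\<in>UNIV. christoffel g x i i l * (\<Sum>j\<in>UNIV. ginv x $ l $ j * gmat x $ j $ e))"
      by (simp add: sum_distrib_left sum_distrib_right mult.assoc) (rule sum.swap)
    then show ?thesis
      by (simp add: ginv_gmat[OF assms] if_distrib sum.delta cong: if_cong)
  qed
  have "(\<Sum>j\<in>UNIV. drift x j * gmat x $ j $ e) =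
      (\<Sum>i\<in>UNIV. (\<Sum>j\<in>UNIV. partial_deriv i (\<lambda>z. ginv z $ i $ j) x * gmat x $ j $ e)
        + (\<Sum>j\<in>UNIV. (\<Sum>l\<in>UNIV. christoffel g x i i l * ginv x $ l $ j) * gmat x $ j $ e))"
    unfolding drift_def sum_distrib_right by (subst sum.swap) (simp add: ring_distribs sum.distrib sum_distrib_right)
  also have "\<dots> = - (\<Sum>i\<in>UNIV. \<Sum>j\<in>UNIV. ginv x $ i $ j * lorentz_product (dd x j i) (d e x))"
    unfolding inv chr unfolding christoffel_eq[OF assms]
    by (simp add: ring_distribs sum.distrib sum_negf dd_commute[OF assms, of e] lorentz_product_commute)
  finally show ?thesis .
qed

text \<open>The second-order part of the componentwise Laplacian. Only its class modulo tangent
  vectors is geometric: its normal part is the dimension times the mean curvature vector in the flat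
  ambient space.\<close>

definition hessian_trace :: "real^'k \<Rightarrow> 'm minkowski_space" where
  "hessian_trace x = (\<Sum>i\<in>UNIV. \<Sum>j\<in>UNIV. ginv x $ i $ j *\<^sub>R dd x j i)"

definition vector_laplace_beltrami :: "real^'k \<Rightarrow> 'm minkowski_space" where
  "vector_laplace_beltrami x = (laplace_beltrami g (\<lambda>z. fst (\<psi> z)) x,
      \<chi> a. laplace_beltrami g (\<lambda>z. snd (\<psi> z) $ a) x)"

lemma laplace_beltrami_component:
  assumes "bounded_linear L" "x \<in> S"
  shows "laplace_beltrami g (\<lambda>z. L (\<psi> z)) x = L (hessian_trace x + (\<Sum>j\<in>UNIV. drift x j *\<^sub>R d j x))"
proof -
  note L = linear_add[OF bounded_linear.linear[OF assms(1)]] linear_sum[OF bounded_linear.linear[OF assms(1)]]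
    linear_scale[OF bounded_linear.linear[OF assms(1)]]
  show ?thesis
    unfolding laplace_beltrami_eq[OF smooth_on_bounded_linear[OF open_domain assms(1) smooth] assms(2)]
    by (simp add: L hessian_trace_def partial_deriv_def frechet_derivative_bounded_linear[OF smooth assms(2,1)]
        second_derivative_bounded_linear[OF open_domain smooth assms(2,1)])
qed

lemma vector_laplace_beltrami_eq:
  assumes "x \<in> S"
  shows "vector_laplace_beltrami x = hessian_trace x + (\<Sum>j\<in>UNIV. drift x j *\<^sub>R d j x)"
  unfolding vector_laplace_beltrami_def laplace_beltrami_component[OF bounded_linear_fst assms]
    laplace_beltrami_component[OF bounded_linear_compose[OF bounded_linear_vec_nth bounded_linear_snd] assms]
  by (simp add: prod_eq_iff vec_eq_iff)

lemma vector_laplace_beltrami_normal: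
  assumes "x \<in> S"
  shows "lorentz_product (vector_laplace_beltrami x) (d e x) = 0"
  unfolding vector_laplace_beltrami_eq[OF assms]
  using drift_lower[OF assms, of e]
  by (simp add: hessian_trace_def lorentz.add_left lorentz.sum_left lorentz.scaleR_left gmat_entry)

lemma g_eq:
  assumes "x \<in> S"
  shows "g x v w = v \<bullet> (gmat x *v w)"
proof -
  note l = linear_axis_expand[OF linear_frechet[OF assms], folded partial_deriv_def]
  have "g x v w = lorentz_product (\<Sum>i\<in>UNIV. v $ i *\<^sub>R d i x) (\<Sum>j\<in>UNIV. w $ j *\<^sub>R d j x)"
    unfolding pull_back_def minkowski_eq l[of v] l[of w] ..
  also have "\<dots> = (\<Sum>i\<in>UNIV. v $ i * (\<Sum>j\<in>UNIV. gmat x $ i $ j * w $ j))"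
    by (simp add: lorentz.sum_left lorentz.scaleR_left lorentz.sum_right lorentz.scaleR_right
        gmat_entry sum_distrib_left mult.assoc mult.left_commute mult.commute)
      (rule sum.swap)
  finally show ?thesis
    by (simp add: inner_vec_def matrix_vector_mult_def)
qed

text \<open>Lowering the index of the gradient returns the partial derivatives, so one of the two
  inverse metrics cancels.\<close>

lemma gradient_square:
  assumes "x \<in> S"
  shows "g x (gradient g f x) (gradient g f x) =
    (\<Sum>i\<in>UNIV. \<Sum>j\<in>UNIV. ginv x $ i $ j * (partial_deriv i f x * partial_deriv j f x))"
proof -
  let ?w = "\<chi> j. partial_deriv j f x"
  have v: "gradient g f x = ginv x *v ?w"
    by (simp add: gradient_def matrix_vector_mult_def)
  then have "gmat x *v gradient g f x = ?w"
    using matrix_inv_works(1)[OF det_nonzero[OF assms]]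
    by (simp add: matrix_vector_mul_assoc inverse_metric_def)
  then have "g x (gradient g f x) (gradient g f x) = (ginv x *v ?w) \<bullet> ?w"
    unfolding g_eq[OF assms] by (simp add: v)
  then show ?thesis
    by (simp add: inner_vec_def matrix_vector_mult_def sum_distrib_left sum_distrib_right mult_ac)
qed

end

section \<open>Reparametrization and the trace identity\<close>

lemma smooth_on_has_real_derivative:
  fixes r :: "real \<Rightarrow> real"
  assumes "open J" "smooth_on J r" "t \<in> J"
  shows "(r has_real_derivative deriv r t) (at t)"
  using smooth_on_has_derivative[OF assms(2,3)] has_real_derivative DERIV_imp_deriv by metis

lemma smooth_on_deriv:
  fixes r :: "real \<Rightarrow> real"
  assumes "open J" "smooth_on J r"
  shows "smooth_on J (deriv r)"
proof (rule smooth_on_cong[OF assms(1) _ smooth_on_frechet_derivative[OF assms(2)]])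
  fix t assume "t \<in> J"
  from smooth_on_has_real_derivative[OF assms this]
  show "frechet_derivative r (at t) 1 = deriv r t"
    unfolding has_field_derivative_def by (metis frechet_derivative_at mult.right_neutral)
qed

text \<open>Half the Lorentzian gradient of |x|^2 - r(t)^2, the function that cuts out
  \<open>Q\<close>. In contrast to \<open>P_field\<close> it lives on the ambient space and can be
  evaluated along charts of M and along parametrizations of the hypersurface alike.\<close>

definition position_normal :: "(real \<Rightarrow> real) \<Rightarrow> 'm::finite minkowski_space \<Rightarrow> 'm minkowski_space" where
  "position_normal r p = (r (fst p) * deriv r (fst p), snd p)"

lemma sum_reverse4:
  "(\<Sum>i\<in>A. \<Sum>j\<in>B. \<Sum>b\<in>C. \<Sum>a\<in>D. f i j b a) = (\<Sum>a\<in>D. \<Sum>b\<in>C. \<Sum>j\<in>B. \<Sum>i\<in>A. f i j b a)"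
proof -
  have "(\<Sum>i\<in>A. \<Sum>j\<in>B. \<Sum>b\<in>C. \<Sum>a\<in>D. f i j b a) = (\<Sum>j\<in>B. \<Sum>i\<in>A. \<Sum>b\<in>C. \<Sum>a\<in>D. f i j b a)"
    by (rule sum.swap)
  also have "\<dots> = (\<Sum>j\<in>B. \<Sum>b\<in>C. \<Sum>i\<in>A. \<Sum>a\<in>D. f i j b a)"
    by (intro sum.cong refl sum.swap)
  also have "\<dots> = (\<Sum>b\<in>C. \<Sum>j\<in>B. \<Sum>a\<in>D. \<Sum>i\<in>A. f i j b a)"
    by (subst sum.swap) (intro sum.cong refl sum.swap)
  also have "\<dots> = (\<Sum>b\<in>C. \<Sum>a\<in>D. \<Sum>j\<in>B. \<Sum>i\<in>A. f i j b a)"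
    by (intro sum.cong refl sum.swap)
  finally show ?thesis by (simp add: sum.swap[of _ C D])
qed

text \<open>To be used with \<open>M\<close> the inverse metric, \<open>T\<close> the Jacobian of a
  chart transition and \<open>B\<close> a second derivative: the trace over a transported basis
  becomes a trace in the other coordinates.\<close>

lemma trace_congruence:
  fixes M :: "real^'k^'k::finite" and T :: "real^'k^'l::finite"
    and B :: "real^'l \<Rightarrow> real^'l \<Rightarrow> 'w::real_vector"
  assumes "\<And>v. linear (B v)" "\<And>w. linear (\<lambda>v. B v w)"
  shows "(\<Sum>i\<in>UNIV. \<Sum>j\<in>UNIV. M $ i $ j *\<^sub>R B (T *v axis j 1) (T *v axis i 1)) =
    (\<Sum>a\<in>UNIV. \<Sum>b\<in>UNIV. (T ** M ** transpose T) $ a $ b *\<^sub>R B (axis b 1) (axis a 1))"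
proof -
  have e: "B v w = (\<Sum>b\<in>UNIV. \<Sum>a\<in>UNIV. (v $ b * w $ a) *\<^sub>R B (axis b 1) (axis a 1))" for v w
    by (subst linear_axis_expand[OF assms(2)], subst linear_axis_expand[OF assms(1)])
      (simp add: scaleR_sum_right)
  have c: "(T *v axis j 1) $ b = T $ b $ j" for j b
    by (simp add: matrix_vector_mult_basis column_def)
  have "(\<Sum>i\<in>UNIV. \<Sum>j\<in>UNIV. M $ i $ j *\<^sub>R B (T *v axis j 1) (T *v axis i 1)) =
      (\<Sum>i\<in>UNIV. \<Sum>j\<in>UNIV. \<Sum>b\<in>UNIV. \<Sum>a\<in>UNIV.
        (M $ i $ j * (T $ b $ j * T $ a $ i)) *\<^sub>R B (axis b 1) (axis a 1))"
    by (subst e) (simp add: c scaleR_sum_right)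
  also have "\<dots> = (\<Sum>a\<in>UNIV. \<Sum>b\<in>UNIV. \<Sum>j\<in>UNIV. \<Sum>i\<in>UNIV.
        (M $ i $ j * (T $ b $ j * T $ a $ i)) *\<^sub>R B (axis b 1) (axis a 1))"
    by (rule sum_reverse4)
  also have "\<dots> = (\<Sum>a\<in>UNIV. \<Sum>b\<in>UNIV. (T ** M ** transpose T) $ a $ b *\<^sub>R B (axis b 1) (axis a 1))"
    by (simp add: matrix_matrix_mult_def transpose_def scaleR_sum_left sum_distrib_left sum_distrib_right mult_ac)
  finally show ?thesis .
qed

context nondegenerate_immersion begin

text \<open>The derivative of P in direction \<open>i\<close> is \<open>d i x\<close> with its time
  component multiplied by \<open>?c\<close>, the derivative of r r'. Were \<open>?c\<close> equal to
  1, pairing with \<open>d j x\<close> would give the metric, of trace k. The excess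
  \<open>?c - 1\<close> meets time components only, and their trace is the squared gradient of the
  time function, see \<open>gradient_square\<close>.\<close>

lemma position_normal_trace_identity:
  assumes "open J" "smooth_on J r" and J: "\<And>z. z \<in> S \<Longrightarrow> fst (\<psi> z) \<in> J"
    and normal: "\<And>z i. z \<in> S \<Longrightarrow> lorentz_product (position_normal r (\<psi> z)) (d i z) = 0"
    and x: "x \<in> S"
  defines "t \<equiv> fst (\<psi> x)"
  shows "lorentz_product (position_normal r (\<psi> x)) (hessian_trace x) + real CARD('k) =
    (deriv (deriv r) t * r t + (deriv r t)\<^sup>2 - 1) *
      (\<Sum>i\<in>UNIV. \<Sum>j\<in>UNIV. ginv x $ i $ j *
        (partial_deriv i (\<lambda>z. fst (\<psi> z)) x * partial_deriv j (\<lambda>z. fst (\<psi> z)) x))"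
proof -
  let ?c = "deriv (deriv r) t * r t + (deriv r t)\<^sup>2"
  let ?P = "position_normal r (\<psi> x)"
  have tJ: "t \<in> J" using J[OF x] by (simp add: t_def)
  have "((\<lambda>t. r t * deriv r t) has_real_derivative ?c) (at t)"
    using DERIV_mult[OF smooth_on_has_real_derivative[OF assms(1,2) tJ]
        smooth_on_has_real_derivative[OF assms(1) smooth_on_deriv[OF assms(1,2)] tJ]]
    by (simp add: power2_eq_square algebra_simps)
  then have d_rr: "((\<lambda>t. r t * deriv r t) has_derivative (\<lambda>h. ?c * h)) (at (fst (\<psi> x)))"
    by (simp add: has_field_derivative_def t_def)
  note d\<psi> = smooth_on_has_derivative[OF smooth x]
  note fst_d = has_derivative_compose[OF has_derivative_fst[OF d\<psi>] d_rr]
  have dP: "((\<lambda>z. position_normal r (\<psi> z)) has_derivative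
      (\<lambda>v. (?c * fst (frechet_derivative \<psi> (at x) v), snd (frechet_derivative \<psi> (at x) v)))) (at x)"
    unfolding position_normal_def by (intro has_derivative_Pair fst_d has_derivative_snd d\<psi>)
  have eq: "lorentz_product ?P (dd x j i) + lorentz_product (d i x) (d j x) =
      (?c - 1) * (fst (d i x) * fst (d j x))" for i j
  proof -
    have "((\<lambda>z. lorentz_product (position_normal r (\<psi> z)) (d j z)) has_derivative (\<lambda>v. 0)) (at x)"
      by (rule has_derivative_transform_within_open[OF has_derivative_const open_domain x]) (simp add: normal)
    from has_derivative_unique[OF lorentz.FDERIV[OF dP partial_deriv_has_derivative[OF smooth x]] this,
        THEN fun_cong, of "axis i 1"]
    have "lorentz_product ?P (dd x j i) + lorentz_product (?c * fst (d i x), snd (d i x)) (d j x) = 0"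
      by (simp add: partial_deriv_def)
    then show ?thesis by (simp add: lorentz_product_def algebra_simps)
  qed
  have fst_partial: "partial_deriv i (\<lambda>z. fst (\<psi> z)) x = fst (d i x)" for i
    unfolding partial_deriv_def by (rule frechet_derivative_bounded_linear[OF smooth x bounded_linear_fst])
  have "(\<Sum>i\<in>UNIV. \<Sum>j\<in>UNIV. ginv x $ i $ j * lorentz_product (d i x) (d j x)) =
      (\<Sum>i\<in>UNIV. \<Sum>j\<in>UNIV. ginv x $ i $ j * gmat x $ j $ i)"
    by (simp add: gmat_entry lorentz_product_commute)
  also have "\<dots> = real CARD('k)"
    by (simp add: ginv_gmat[OF x])
  finally have "lorentz_product ?P (hessian_trace x) + real CARD('k) =
      (\<Sum>i\<in>UNIV. \<Sum>j\<in>UNIV. ginv x $ i $ j *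
        (lorentz_product ?P (dd x j i) + lorentz_product (d i x) (d j x)))"
    by (simp add: hessian_trace_def lorentz.sum_right lorentz.scaleR_right ring_distribs sum.distrib)
  then show ?thesis
    unfolding eq fst_partial by (simp add: sum_distrib_left mult_ac)
qed

text \<open>Inverse metrics transform by congruence with the Jacobian \<open>T\<close>, so the first
  summand of the chain rule is traced to the Hessian trace in the other coordinates, and the second
  is a tangent vector. Tangent spaces agree because \<open>T\<close> is invertible.\<close>

lemma hessian_trace_reparametrize:
  fixes \<psi>0 :: "real^'k \<Rightarrow> 'm minkowski_space"
  assumes "nondegenerate_immersion S0 \<psi>0" and \<tau>: "smooth_on S \<tau>" "\<tau> ` S \<subseteq> S0"
    and \<psi>: "\<And>z. z \<in> S \<Longrightarrow> \<psi> z = \<psi>0 (\<tau> z)" and x: "x \<in> S"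
  shows "\<exists>v. hessian_trace x = nondegenerate_immersion.hessian_trace \<psi>0 (\<tau> x)
    + frechet_derivative \<psi>0 (at (\<tau> x)) v"
    and "range (frechet_derivative \<psi> (at x)) = range (frechet_derivative \<psi>0 (at (\<tau> x)))"
proof -
  interpret N0: nondegenerate_immersion S0 \<psi>0 by fact
  have \<tau>x: "\<tau> x \<in> S0" using \<tau>(2) x by auto
  define T where "T = matrix (frechet_derivative \<tau> (at x))"
  have T: "frechet_derivative \<tau> (at x) v = T *v v" for v
    using matrix_works smooth_on_linear[OF \<tau>(1) x] by (simp add: T_def)
  have "frechet_derivative \<psi> (at x) v = frechet_derivative (\<lambda>z. \<psi>0 (\<tau> z)) (at x) v" for v
    by (subst frechet_derivative_transform_within_open[OF _ open_domain x \<psi>])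
      (use smooth_on_has_derivative[OF smooth x] in \<open>auto simp: differentiable_def\<close>)
  then have d1: "frechet_derivative \<psi> (at x) v = frechet_derivative \<psi>0 (at (\<tau> x)) (T *v v)" for v
    by (simp add: frechet_derivative_compose_smooth[OF \<tau>(1) N0.smooth x \<tau>x] T)
  have d2: "dd x j i = second_derivative \<psi>0 (\<tau> x) (T *v axis j 1) (T *v axis i 1)
      + frechet_derivative \<psi>0 (at (\<tau> x)) (second_derivative \<tau> x (axis j 1) (axis i 1))" for i j
  proof -
    have "second_derivative (\<lambda>z. \<psi>0 (\<tau> z)) x (axis j 1) (axis i 1) = dd x j i"
    proof (rule second_derivative_eqI[OF open_domain x])
      show "((\<lambda>z. \<psi>0 (\<tau> z)) has_derivative frechet_derivative \<psi> (at z)) (at z)" if "z \<in> S" for z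
        by (rule has_derivative_transform_within_open[OF smooth_on_has_derivative[OF smooth that] open_domain that \<psi>])
      show "((\<lambda>z. frechet_derivative \<psi> (at z) (axis j 1)) has_derivative
          second_derivative \<psi> x (axis j 1)) (at x)"
        by (rule has_second_derivative[OF smooth x])
    qed
    then show ?thesis
      unfolding second_derivative_compose[OF open_domain \<tau>(1) N0.open_domain N0.smooth \<tau>(2) x] T by simp
  qed
  have G: "gmat x = transpose T ** N0.gmat (\<tau> x) ** T"
  proof -
    have "v \<bullet> (gmat x *v w) = v \<bullet> ((transpose T ** N0.gmat (\<tau> x) ** T) *v w)" for v w
    proof -
      have "v \<bullet> (gmat x *v w) = N0.g (\<tau> x) (T *v v) (T *v w)"
        unfolding g_eq[OF x, symmetric] by (simp add: pull_back_def minkowski_eq d1)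
      also have "\<dots> = (T *v v) \<bullet> (N0.gmat (\<tau> x) *v (T *v w))"
        by (rule N0.g_eq[OF \<tau>x])
      also have "\<dots> = v \<bullet> (transpose T *v (N0.gmat (\<tau> x) *v (T *v w)))"
        by (metis dot_lmul_matrix inner_commute transpose_matrix_vector)
      finally show ?thesis by (simp add: matrix_vector_mul_assoc matrix_mul_assoc)
    qed
    then have "gmat x *v w = (transpose T ** N0.gmat (\<tau> x) ** T) *v w" for w
      using vector_eq_ldot by blast
    then show ?thesis unfolding matrix_eq by blast
  qed
  \<comment> \<open>Invertibility of the Jacobian is read off the congruence \<open>G\<close>: the
    left-hand side is nondegenerate.\<close>
  then have detT: "det T \<noteq> 0"
    using det_nonzero[OF x] by (auto simp: det_mul)
  note Tinv = matrix_inv_works[OF detT]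
  have N: "T ** ginv x ** transpose T = N0.ginv (\<tau> x)"
  proof -
    let ?N = "T ** ginv x ** transpose T"
    have "?N ** N0.gmat (\<tau> x) ** T = T ** (ginv x ** gmat x)"
      by (simp add: G matrix_mul_assoc)
    also have "\<dots> = T"
      using matrix_inv_works(2)[OF det_nonzero[OF x]] by (simp add: inverse_metric_def)
    finally have "?N ** N0.gmat (\<tau> x) ** T ** matrix_inv T = mat 1"
      using Tinv by simp
    then have "?N ** N0.gmat (\<tau> x) = mat 1"
      using Tinv by (simp add: matrix_mul_assoc[symmetric])
    then have "?N ** N0.gmat (\<tau> x) ** N0.ginv (\<tau> x) = N0.ginv (\<tau> x)" by simp
    then show ?thesis
      using matrix_inv_works(1)[OF N0.det_nonzero[OF \<tau>x]]
      by (simp add: inverse_metric_def matrix_mul_assoc[symmetric])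
  qed
  have lin: "linear (frechet_derivative \<psi>0 (at (\<tau> x)))" by (rule N0.linear_frechet[OF \<tau>x])
  have "hessian_trace x =
      (\<Sum>i\<in>UNIV. \<Sum>j\<in>UNIV. ginv x $ i $ j *\<^sub>R second_derivative \<psi>0 (\<tau> x) (T *v axis j 1) (T *v axis i 1))
      + frechet_derivative \<psi>0 (at (\<tau> x))
        (\<Sum>i\<in>UNIV. \<Sum>j\<in>UNIV. ginv x $ i $ j *\<^sub>R second_derivative \<tau> x (axis j 1) (axis i 1))"
    by (simp add: hessian_trace_def d2 linear_sum[OF lin] linear_scale[OF lin] sum.distrib scaleR_add_right)
  also have "(\<Sum>i\<in>UNIV. \<Sum>j\<in>UNIV. ginv x $ i $ j *\<^sub>R second_derivative \<psi>0 (\<tau> x) (T *v axis j 1) (T *v axis i 1))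
      = N0.hessian_trace (\<tau> x)"
    by (subst trace_congruence)
      (simp_all add: linear_second_derivative[OF N0.open_domain N0.smooth \<tau>x] N N0.hessian_trace_def)
  finally show "\<exists>v. hessian_trace x = N0.hessian_trace (\<tau> x) + frechet_derivative \<psi>0 (at (\<tau> x)) v"
    by blast
  show "range (frechet_derivative \<psi> (at x)) = range (frechet_derivative \<psi>0 (at (\<tau> x)))"
  proof
    show "range (frechet_derivative \<psi>0 (at (\<tau> x))) \<subseteq> range (frechet_derivative \<psi> (at x))"
    proof
      fix w assume "w \<in> range (frechet_derivative \<psi>0 (at (\<tau> x)))"
      then obtain v where "w = frechet_derivative \<psi>0 (at (\<tau> x)) v" by auto
      then have "w = frechet_derivative \<psi> (at x) (matrix_inv T *v v)"
        by (simp add: d1 matrix_vector_mul_assoc Tinv)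
      then show "w \<in> range (frechet_derivative \<psi> (at x))" by blast
    qed
  qed (auto simp: d1)
qed

end

text \<open>The left inverse \<open>L\<close> of the derivative of \<open>y\<close> gives a map
  \<open>R\<close>, the identity minus \<open>L\<close> after \<open>y\<close>, whose derivative
  vanishes at \<open>u x\<close>. An increment of \<open>u\<close> is that of \<open>\<phi>\<close>
  plus that of \<open>R\<close> along \<open>u\<close>. The latter is of smaller order than the
  increment of \<open>u\<close>, so absorbing it shows first a Lipschitz bound for \<open>u\<close>
  at \<open>x\<close>, and then that it is of smaller order than \<open>z - x\<close>.\<close>

lemma has_derivative_lift:
  assumes y: "(y has_derivative y') (at (u x))" and L: "bounded_linear L" "\<And>v. L (y' v) = v"
    and \<psi>: "(\<psi> has_derivative \<psi>') (at x)" and u: "isCont u x"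
    and S: "open S" "x \<in> S" "\<And>z. z \<in> S \<Longrightarrow> y (u z) = \<psi> z"
  shows "(u has_derivative (\<lambda>v. L (\<psi>' v))) (at x)"
proof -
  define \<phi> where "\<phi> z = L (\<psi> z)" for z
  define R where "R w = w - L (y w)" for w
  have d\<phi>: "(\<phi> has_derivative (\<lambda>v. L (\<psi>' v))) (at x)"
    unfolding \<phi>_def by (rule bounded_linear.has_derivative[OF L(1) \<psi>])
  have "(R has_derivative (\<lambda>v. v - L (y' v))) (at (u x))"
    unfolding R_def by (intro has_derivative_diff has_derivative_ident bounded_linear.has_derivative[OF L(1) y])
  then have dR: "(R has_derivative (\<lambda>v. 0)) (at (u x))" by (simp add: L(2))
  obtain K where K: "K > 0" "\<And>v. norm (L (\<psi>' v)) \<le> norm v * K"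
    using bounded_linear.pos_bounded[OF has_derivative_bounded_linear[OF d\<phi>]] by blast
  show ?thesis
    unfolding has_derivative_at_alt
  proof (intro conjI allI impI)
    show "bounded_linear (\<lambda>v. L (\<psi>' v))" by (rule has_derivative_bounded_linear[OF d\<phi>])
    fix e :: real assume "e > 0"
    \<comment> \<open>The bound 1/2 lets half of the increment of \<open>u\<close> be absorbed,
      which gives the Lipschitz constant 2 (K + 1). The other bound makes \<open>e1\<close> times
      this constant at most e / 2.\<close>
    define e1 where "e1 = min (1 / 2) (e / (4 * (K + 1)))"
    have e1: "e1 > 0" "e1 \<le> 1 / 2" "e1 \<le> e / (4 * (K + 1))"
      using \<open>e > 0\<close> K(1) unfolding e1_def by (simp, intro min.cobounded1, intro min.cobounded2)
    then have e1_le: "e1 * (4 * (K + 1)) \<le> e" using K(1) by (simp add: pos_le_divide_eq)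
    obtain d1 where d1: "d1 > 0" "\<And>w. norm (w - u x) < d1 \<Longrightarrow> norm (R w - R (u x)) \<le> e1 * norm (w - u x)"
      using dR e1(1) unfolding has_derivative_at_alt by auto
    obtain d2 where d2: "d2 > 0" "\<And>z. norm (z - x) < d2 \<Longrightarrow> norm (u z - u x) < d1"
      using u d1(1) unfolding continuous_at_eps_delta dist_norm by blast
    \<comment> \<open>The bound 1 yields the constant K + 1 for increments of \<open>\<phi>\<close>;
      e / 2 is the other half of the final error.\<close>
    define e2 where "e2 = min 1 (e / 2)"
    have e2: "e2 > 0" "e2 \<le> 1" "e2 \<le> e / 2" using \<open>e > 0\<close> by (auto simp: e2_def)
    obtain d3 where d3: "d3 > 0"
      "\<And>z. norm (z - x) < d3 \<Longrightarrow> norm (\<phi> z - \<phi> x - L (\<psi>' (z - x))) \<le> e2 * norm (z - x)"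
      using d\<phi> e2(1) unfolding has_derivative_at_alt by blast
    obtain d4 where d4: "d4 > 0" "\<And>z. norm (z - x) < d4 \<Longrightarrow> z \<in> S"
      using S(1,2) unfolding open_dist dist_norm by blast
    show "\<exists>d>0. \<forall>z. norm (z - x) < d \<longrightarrow> norm (u z - u x - L (\<psi>' (z - x))) \<le> e * norm (z - x)"
    proof (intro exI conjI allI impI)
      show "min d2 (min d3 d4) > 0" using d2 d3 d4 by simp
      fix z assume z: "norm (z - x) < min d2 (min d3 d4)"
      have R: "norm (R (u z) - R (u x)) \<le> e1 * norm (u z - u x)" using z d1 d2 by simp
      have \<phi>: "norm (\<phi> z - \<phi> x - L (\<psi>' (z - x))) \<le> e2 * norm (z - x)" using z d3 by simp
      have eq: "u z - u x = (\<phi> z - \<phi> x) + (R (u z) - R (u x))"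
        using S(3)[OF S(2)] S(3)[of z] d4(2)[of z] z by (simp add: R_def \<phi>_def)
      have "norm (\<phi> z - \<phi> x) \<le> norm (\<phi> z - \<phi> x - L (\<psi>' (z - x))) + norm (L (\<psi>' (z - x)))"
        by (metis add_diff_cancel_left' diff_add_cancel norm_triangle_ineq)
      also have "\<dots> \<le> 1 * norm (z - x) + norm (z - x) * K"
        using \<phi> e2(2) K(2)[of "z - x"] mult_right_mono[OF e2(2), of "norm (z - x)"] by simp
      finally have "norm (\<phi> z - \<phi> x) \<le> (K + 1) * norm (z - x)" by (simp add: algebra_simps)
      moreover have "norm (u z - u x) \<le> norm (\<phi> z - \<phi> x) + norm (R (u z) - R (u x))"
        unfolding eq by (rule norm_triangle_ineq)
      moreover have "e1 * norm (u z - u x) \<le> 1 / 2 * norm (u z - u x)"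
        using e1(2) by (intro mult_right_mono) auto
      ultimately have "norm (u z - u x) \<le> 2 * (K + 1) * norm (z - x)" using R by linarith
      then have "e1 * norm (u z - u x) \<le> e1 * (2 * (K + 1) * norm (z - x))"
        using e1(1) by (intro mult_left_mono) auto
      also have "\<dots> = (e1 * (4 * (K + 1))) / 2 * norm (z - x)" by simp
      also have "\<dots> \<le> e / 2 * norm (z - x)"
        using e1_le by (intro mult_right_mono divide_right_mono) auto
      finally have "norm (R (u z) - R (u x)) \<le> e / 2 * norm (z - x)" using R by linarith
      moreover have "e2 * norm (z - x) \<le> e / 2 * norm (z - x)"
        using e2(3) by (intro mult_right_mono) auto
      moreover have "norm (u z - u x - L (\<psi>' (z - x))) \<le>
          norm (\<phi> z - \<phi> x - L (\<psi>' (z - x))) + norm (R (u z) - R (u x))"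
        unfolding eq using norm_triangle_ineq[of "\<phi> z - \<phi> x - L (\<psi>' (z - x))" "R (u z) - R (u x)"]
        by (simp add: algebra_simps)
      ultimately show "norm (u z - u x - L (\<psi>' (z - x))) \<le> e * norm (z - x)"
        using \<phi> by (simp add: field_simps)
    qed
  qed
qed

text \<open>Bootstrapping: the derivative of \<open>u\<close> is \<open>L (u x)\<close> applied to
  the derivative of \<open>\<psi>\<close>. If \<open>u\<close> is of class n, so is this expression,
  and \<open>u\<close> is of class n + 1; continuity starts the induction.\<close>

lemma smooth_on_lift:
  fixes y :: "real^'m::finite \<Rightarrow> 'w::euclidean_space" and \<psi> :: "'v::real_normed_vector \<Rightarrow> 'w"
  assumes V: "open V" "smooth_on V y" "\<And>z. z \<in> V \<Longrightarrow> inj (frechet_derivative y (at z))"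
    and D: "open D" "smooth_on D \<psi>" and u: "u ` D \<subseteq> V" "\<And>x. x \<in> D \<Longrightarrow> y (u x) = \<psi> x" "continuous_on D u"
  shows "smooth_on D u"
proof -
  \<comment> \<open>The Gram matrix of the differential of \<open>y\<close> for the Euclidean inner
    product, invertible as soon as that differential is injective. \<open>L\<close> is the
    least-squares left inverse built from it; being explicit, it is visibly smooth in the base
    point.\<close>
  define G where "G z = (\<chi> a b. partial_deriv a y z \<bullet> partial_deriv b y z)" for z
  define L where "L z w = (\<chi> a. \<Sum>b\<in>UNIV. matrix_inv (G z) $ a $ b * (partial_deriv b y z \<bullet> w))" for z w
  have Gv: "(G z *v v) $ a = partial_deriv a y z \<bullet> frechet_derivative y (at z) v" if "z \<in> V" for z v a
    by (subst linear_axis_expand[OF smooth_on_linear[OF V(2) that]])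
      (simp add: G_def matrix_vector_mult_def inner_sum_right partial_deriv_def mult.commute)
  have detG: "det (G z) \<noteq> 0" if "z \<in> V" for z
  proof (rule det_nonzeroI)
    fix v assume v: "G z *v v = 0"
    have "frechet_derivative y (at z) v \<bullet> frechet_derivative y (at z) v = v \<bullet> (G z *v v)"
      by (subst (1) linear_axis_expand[OF smooth_on_linear[OF V(2) that]])
        (simp add: inner_sum_left inner_vec_def Gv[OF that] partial_deriv_def)
    then have "frechet_derivative y (at z) v = frechet_derivative y (at z) 0"
      using v linear_0[OF smooth_on_linear[OF V(2) that]] by simp
    then show "v = 0" using V(3)[OF that] by (simp add: inj_eq)
  qed
  have L_left: "L z (frechet_derivative y (at z) v) = v" if "z \<in> V" for z v
  proof -
    have "L z (frechet_derivative y (at z) v) = matrix_inv (G z) *v (G z *v v)"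
      by (simp add: L_def Gv[OF that, symmetric]) (simp add: matrix_vector_mult_def)
    then show ?thesis by (simp add: matrix_vector_mul_assoc matrix_inv_works[OF detG[OF that]])
  qed
  have "linear (L z)" for z
    by (rule linearI) (simp_all add: L_def vec_eq_iff inner_add_right sum.distrib algebra_simps sum_distrib_left)
  then have L_lin: "bounded_linear (L z)" for z by (rule linear_conv_bounded_linear[THEN iffD1])
  have du: "(u has_derivative (\<lambda>v. L (u x) (frechet_derivative \<psi> (at x) v))) (at x)" if "x \<in> D" for x
  proof (rule has_derivative_lift[OF smooth_on_has_derivative[OF V(2)] L_lin L_left
        smooth_on_has_derivative[OF D(2) that] _ D(1) that u(2)])
    show "u x \<in> V" "u x \<in> V" using u(1) that by auto
    show "isCont u x" using u(3) D(1) that by (simp add: continuous_on_eq_continuous_at)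
  qed
  have smG: "C_k_on n V (\<lambda>z. G z $ a $ b)" for n a b
    unfolding G_def vec_lambda_beta
    by (intro C_k_on_inner V(1) smooth_on_D smooth_on_partial_deriv V(2))
  have "C_k_on n D u" for n
  proof (induction n)
    case 0
    then show ?case using u(3) by simp
  next
    case (Suc n)
    show ?case
    proof (rule C_k_on_SucI[OF D(1) du])
      fix v
      show "C_k_on n D (\<lambda>x. L (u x) (frechet_derivative \<psi> (at x) v))"
      proof (rule C_k_on_vec[OF D(1)])
        fix a
        show "C_k_on n D (\<lambda>x. L (u x) (frechet_derivative \<psi> (at x) v) $ a)"
          unfolding L_def vec_lambda_beta
          by (intro C_k_on_sum C_k_on_mult C_k_on_inner D(1) C_k_on_compose[OF D(1) u(1) Suc.IH]
              C_k_on_matrix_inv V(1) smG detG smooth_on_D[OF smooth_on_partial_deriv[OF V(2)]]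
              smooth_on_D[OF smooth_on_frechet_derivative[OF D(2)]])
      qed
    qed
  qed
  then show ?thesis by (simp add: smooth_on_def)
qed

section \<open>The hypersurface\<close>

lemma mem_Q: "p \<in> Q J r \<longleftrightarrow> fst p \<in> J \<and> snd p \<bullet> snd p = (r (fst p))\<^sup>2"
  by (cases p) (simp add: Q_def inner_vec_def power2_eq_square)

text \<open>The function |x|^2 - r(t)^2 vanishes along \<open>y\<close>; its derivative is twice the
  pairing with the position field.\<close>

lemma position_normal_orthogonal:
  assumes J: "open J" "smooth_on J r" and y: "open V" "smooth_on V y" "y ` V \<subseteq> Q J r" "z \<in> V"
  shows "lorentz_product (position_normal r (y z)) (frechet_derivative y (at z) v) = 0"
proof -
  let ?D = "frechet_derivative y (at z)"
  let ?t = "fst (y z)"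
  have t: "?t \<in> J" using y(3,4) by (auto simp: mem_Q)
  note dy = smooth_on_has_derivative[OF y(2,4)]
  have dr: "(r has_derivative (\<lambda>h. deriv r ?t * h)) (at (fst (y z)))"
    using smooth_on_has_real_derivative[OF J t] by (simp add: has_field_derivative_def)
  have "((\<lambda>z. snd (y z) \<bullet> snd (y z) - r (fst (y z)) * r (fst (y z))) has_derivative
      (\<lambda>v. (snd (y z) \<bullet> snd (?D v) + snd (?D v) \<bullet> snd (y z))
        - (r ?t * (deriv r ?t * fst (?D v)) + deriv r ?t * fst (?D v) * r ?t))) (at z)"
    by (intro has_derivative_diff has_derivative_inner has_derivative_mult has_derivative_snd dy
        has_derivative_compose[OF has_derivative_fst[OF dy] dr])
  moreover have "((\<lambda>z. snd (y z) \<bullet> snd (y z) - r (fst (y z)) * r (fst (y z))) has_derivative (\<lambda>v. 0)) (at z)"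
    by (rule has_derivative_transform_within_open[OF has_derivative_const y(1,4)])
      (use y(3) in \<open>auto simp: mem_Q image_subset_iff power2_eq_square\<close>)
  ultimately have "(snd (y z) \<bullet> snd (?D v) + snd (?D v) \<bullet> snd (y z))
        - (r ?t * (deriv r ?t * fst (?D v)) + deriv r ?t * fst (?D v) * r ?t) = 0"
    by (rule has_derivative_unique[THEN fun_cong])
  then show ?thesis
    by (simp add: position_normal_def lorentz_product_def inner_commute algebra_simps)
qed

section \<open>Linear algebra of a hyperplane with non-null normal\<close>

lemma position_normal_square:
  "lorentz_product (position_normal r p) (position_normal r p) =
    snd p \<bullet> snd p - (r (fst p))\<^sup>2 * (deriv r (fst p))\<^sup>2"
  by (simp add: position_normal_def lorentz_product_def power2_eq_square)

text \<open>Flipping the time component of \<open>n\<close> turns Lorentz orthogonality into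
  Euclidean orthogonality to a nonzero vector. The range of \<open>L\<close> lies in that hyperplane
  and has its dimension, CARD('m).\<close>

lemma lorentz_orthogonal_complement:
  fixes L :: "real^'m::finite \<Rightarrow> 'm minkowski_space"
  assumes L: "linear L" "inj L" "\<And>v. lorentz_product n (L v) = 0" and n: "lorentz_product n n \<noteq> 0"
    and w: "lorentz_product n w = 0"
  shows "w \<in> range L"
proof -
  let ?n = "(- fst n, snd n)"
  have eq: "lorentz_product n w = ?n \<bullet> w" for w
    by (simp add: lorentz_product_def inner_prod_def)
  have "?n \<noteq> 0" using n by (auto simp: eq)
  then have "dim {w. ?n \<bullet> w = 0} = dim (range L)"
    using dim_hyperplane[of ?n] dim_image_eq[OF L(1), of UNIV] L(2) by simp
  then have "range L = {w. ?n \<bullet> w = 0}"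
    using L(3) by (intro subspace_dim_equal subspace_hyperplane linear_subspace_image[OF L(1)])
      (auto simp: eq)
  then show ?thesis using w by (simp add: eq)
qed

text \<open>As \<open>n\<close> is not null, subtracting \<open>?a\<close> times \<open>n\<close>
  splits every vector into a multiple of \<open>n\<close> and a vector in the range of
  \<open>L\<close>. Both are orthogonal to \<open>L v\<close>, and the Lorentz product on the whole
  space is nondegenerate.\<close>

lemma lorentz_nondegenerate_on_range:
  fixes L :: "real^'m::finite \<Rightarrow> 'm minkowski_space"
  assumes L: "linear L" "inj L" "\<And>v. lorentz_product n (L v) = 0" and n: "lorentz_product n n \<noteq> 0"
    and v: "\<And>w. lorentz_product (L v) (L w) = 0"
  shows "v = 0"
proof -
  have "lorentz_product (L v) w = 0" for w
  proof -
    let ?a = "lorentz_product n w / lorentz_product n n"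
    have "lorentz_product n (w - ?a *\<^sub>R n) = 0"
      using n by (simp add: lorentz.diff_right lorentz.scaleR_right)
    then obtain w' where "w - ?a *\<^sub>R n = L w'"
      using lorentz_orthogonal_complement[OF L n] by blast
    then obtain c where "w = c *\<^sub>R n + L w'" by (metis add.commute diff_add_cancel)
    then show ?thesis
      using v[of w'] L(3)[of v] lorentz_product_commute[of n "L v"]
      by (simp add: lorentz.add_right lorentz.scaleR_right)
  qed
  then have "L v = 0" by (rule lorentz_product_nondegenerate)
  then show ?thesis using L(1,2) by (metis inj_eq linear_0)
qed

lemma nondegenerate_immersionI:
  assumes "open S" "smooth_on S \<psi>"
    and "\<And>x v. x \<in> S \<Longrightarrow>
      (\<And>w. lorentz_product (frechet_derivative \<psi> (at x) v) (frechet_derivative \<psi> (at x) w) = 0) \<Longrightarrow> v = 0"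
  shows "nondegenerate_immersion S \<psi>"
proof
  fix x assume x: "x \<in> S"
  note l = linear_axis_expand[OF smooth_on_linear[OF assms(2) x]]
  show "det (metric_matrix (pull_back minkowski \<psi>) x) \<noteq> 0"
  proof (rule det_nonzeroI)
    fix v assume v: "metric_matrix (pull_back minkowski \<psi>) x *v v = 0"
    have "lorentz_product (frechet_derivative \<psi> (at x) (axis i 1)) (frechet_derivative \<psi> (at x) v)
        = (metric_matrix (pull_back minkowski \<psi>) x *v v) $ i" for i
      by (subst l[of v]) (simp add: matrix_vector_mult_def metric_matrix_def pull_back_def minkowski_eq
          lorentz.sum_right lorentz.scaleR_right mult.commute)
    then have "lorentz_product (frechet_derivative \<psi> (at x) v) (frechet_derivative \<psi> (at x) w) = 0" for w
      using v by (subst l[of w])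
        (simp add: lorentz.sum_right lorentz.scaleR_right lorentz_product_commute[of _ "frechet_derivative \<psi> (at x) (axis _ 1)"])
    then show "v = 0" by (rule assms(3)[OF x])
  qed
qed (use assms in auto)

text \<open>The quantity plays two roles: it is the denominator of q, and on Q(r) it is the Lorentz
  square of P.\<close>

lemma admissible_nonzero:
  assumes "admissible J r" "t \<in> J"
  shows "(r t)\<^sup>2 * (1 - (deriv r t)\<^sup>2) \<noteq> 0"
  using assms abs_square_less_1[of "deriv r t"] by (auto simp: admissible_def)

text \<open>On Q(r) the position field is normal with nonzero square, so its orthogonal complement,
  the tangent space, inherits a nondegenerate form.\<close>

lemma local_parametrization_Q:
  assumes J: "open J" "admissible J r" and y: "local_parametrization (Q J r) V y"
  shows "nondegenerate_immersion V y"
    and "z \<in> V \<Longrightarrow> lorentz_product (position_normal r (y z)) (frechet_derivative y (at z) v) = 0"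
proof -
  have V: "open V" "smooth_on V y" "y ` V \<subseteq> Q J r" and inj: "\<And>z. z \<in> V \<Longrightarrow> inj (frechet_derivative y (at z))"
    using y openin_imp_subset unfolding local_parametrization_def by blast+
  have sm: "smooth_on J r" using J(2) by (simp add: admissible_def)
  note orth = position_normal_orthogonal[OF J(1) sm V]
  then show "z \<in> V \<Longrightarrow> lorentz_product (position_normal r (y z)) (frechet_derivative y (at z) v) = 0" .
  show "nondegenerate_immersion V y"
  proof (rule nondegenerate_immersionI[OF V(1,2)])
    fix z v assume z: "z \<in> V"
      and v: "\<And>w. lorentz_product (frechet_derivative y (at z) v) (frechet_derivative y (at z) w) = 0"
    have "y z \<in> Q J r" using V(3) z by auto
    then have "lorentz_product (position_normal r (y z)) (position_normal r (y z)) \<noteq> 0"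
      unfolding position_normal_square mem_Q using admissible_nonzero[OF J(2), of "fst (y z)"]
      by (simp add: algebra_simps)
    then show "v = 0"
      using lorentz_nondegenerate_on_range[OF smooth_on_linear[OF V(2) z] inj[OF z] orth[OF z] _ v] by blast
  qed
qed

section \<open>Mean curvature inside a hypersurface\<close>

context nondegenerate_immersion begin

lemma gmat_mult:
  assumes "x \<in> S"
  shows "(gmat x *v v) $ i = lorentz_product (frechet_derivative \<psi> (at x) v) (d i x)"
  by (subst lorentz_product_commute, subst linear_axis_expand[OF linear_frechet[OF assms]])
    (simp add: matrix_vector_mult_def lorentz.sum_right lorentz.scaleR_right gmat_entry partial_deriv_def
      mult.commute)

text \<open>Gauss formula: paired with tangent vectors of the hypersurface, the covariant derivative
  along \<open>u\<close> agrees with the flat second derivative of \<open>\<psi>\<close>. The normal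
  vector \<open>n\<close> drops out of such pairings, so the traced covariant derivative
  \<open>a\<close> equals \<open>?du v\<close>. This is tangent to the image of \<open>u\<close>,
  hence its own tangential projection, and the second fundamental form has trace zero.\<close>

lemma mean_curvature_vector_eq_0:
  fixes y :: "real^'m \<Rightarrow> 'm minkowski_space"
  assumes H: "nondegenerate_immersion V y"
    and u: "smooth_on S u" "u ` S \<subseteq> V" "\<And>z. z \<in> S \<Longrightarrow> \<psi> z = y (u z)"
    and x: "x \<in> S" and normal: "\<And>w. lorentz_product n (frechet_derivative y (at (u x)) w) = 0"
    and trace: "hessian_trace x = n + frechet_derivative \<psi> (at x) v"
  shows "mean_curvature_vector (pull_back minkowski y) u x = 0"
proof -
  interpret H: nondegenerate_immersion V y by fact
  have ux: "u x \<in> V" using u(2) x by auto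
  let ?dy = "frechet_derivative y (at (u x))"
  let ?du = "frechet_derivative u (at x)"
  have lin_y: "linear ?dy" by (rule H.linear_frechet[OF ux])
  have lin_u: "linear ?du" by (rule smooth_on_linear[OF u(1) x])
  have comp: "((\<lambda>z. y (u z)) has_derivative frechet_derivative \<psi> (at z)) (at z)" if "z \<in> S" for z
    by (rule has_derivative_transform_within_open[OF smooth_on_has_derivative[OF smooth that] open_domain that u(3)])
  have d\<psi>: "frechet_derivative \<psi> (at x) w = ?dy (?du w)" for w
    using frechet_derivative_at[OF comp[OF x]] frechet_derivative_compose_smooth[OF u(1) H.smooth x ux]
    by metis
  have dd_eq: "dd x j i = second_derivative y (u x) (partial_deriv j u x) (partial_deriv i u x)
      + ?dy (partial_deriv i (partial_deriv j u) x)" for i j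
    using second_derivative_eqI[OF open_domain x comp has_second_derivative[OF smooth x], of "axis j 1" "axis i 1"]
      second_derivative_compose[OF open_domain u(1) H.open_domain H.smooth u(2) x, of "axis j 1" "axis i 1"]
    by (simp add: second_derivative_axis partial_deriv_def[symmetric])
  have dy_eq: "?dy w = (\<Sum>c\<in>UNIV. w $ c *\<^sub>R H.d c (u x))" for w
    using linear_axis_expand[OF lin_y, of w] by (simp add: partial_deriv_def)
  let ?\<Gamma> = "\<lambda>i j. \<chi> c. \<Sum>a\<in>UNIV. \<Sum>b\<in>UNIV. christoffel H.g (u x) c a b *
        partial_deriv i u x $ a * partial_deriv j u x $ b"
  \<comment> \<open>By \<open>H.christoffel_lower\<close>, the Christoffel term stands for the
    tangential part of the second derivative of \<open>y\<close>.\<close>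
  have \<Gamma>: "lorentz_product (?dy (?\<Gamma> i j)) (H.d e (u x)) =
      lorentz_product (second_derivative y (u x) (partial_deriv j u x) (partial_deriv i u x)) (H.d e (u x))" for i j e
  proof -
    let ?i = "partial_deriv i u x" and ?j = "partial_deriv j u x"
    have "lorentz_product (?dy (?\<Gamma> i j)) (H.d e (u x)) = (\<Sum>c\<in>UNIV. \<Sum>a\<in>UNIV. \<Sum>b\<in>UNIV.
        christoffel H.g (u x) c a b * ?i $ a * ?j $ b * H.gmat (u x) $ c $ e)"
      by (simp add: dy_eq lorentz.sum_left lorentz.scaleR_left H.gmat_entry sum_distrib_right)
    also have "\<dots> = (\<Sum>a\<in>UNIV. \<Sum>c\<in>UNIV. \<Sum>b\<in>UNIV.
        christoffel H.g (u x) c a b * ?i $ a * ?j $ b * H.gmat (u x) $ c $ e)"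
      by (rule sum.swap)
    also have "\<dots> = (\<Sum>a\<in>UNIV. \<Sum>b\<in>UNIV. \<Sum>c\<in>UNIV.
        christoffel H.g (u x) c a b * ?i $ a * ?j $ b * H.gmat (u x) $ c $ e)"
      by (intro sum.cong refl sum.swap)
    also have "\<dots> = (\<Sum>a\<in>UNIV. \<Sum>b\<in>UNIV. ?i $ a * ?j $ b *
        (\<Sum>c\<in>UNIV. christoffel H.g (u x) c a b * H.gmat (u x) $ c $ e))"
      by (simp add: sum_distrib_left mult_ac)
    also have "\<dots> = lorentz_product (\<Sum>a\<in>UNIV. \<Sum>b\<in>UNIV. (?i $ a * ?j $ b) *\<^sub>R H.dd (u x) a b) (H.d e (u x))"
      by (simp add: H.christoffel_lower[OF ux] lorentz.sum_left lorentz.scaleR_left)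
    also have "(\<Sum>a\<in>UNIV. \<Sum>b\<in>UNIV. (?i $ a * ?j $ b) *\<^sub>R H.dd (u x) a b) = second_derivative y (u x) ?i ?j"
    proof -
      have "second_derivative y (u x) ?i ?j =
          (\<Sum>a\<in>UNIV. ?i $ a *\<^sub>R second_derivative y (u x) (axis a 1) ?j)"
        by (rule linear_axis_expand[OF linear_second_derivative(2)[OF H.open_domain H.smooth ux]])
      also have "\<dots> = (\<Sum>a\<in>UNIV. ?i $ a *\<^sub>R (\<Sum>b\<in>UNIV. ?j $ b *\<^sub>R H.dd (u x) a b))"
        by (intro sum.cong refl arg_cong[where f = "\<lambda>w. _ *\<^sub>R w"]
            linear_axis_expand[OF linear_second_derivative(1)[OF H.open_domain H.smooth ux]])
      finally show ?thesis by (simp add: scaleR_sum_right)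
    qed
    also have "\<dots> = second_derivative y (u x) ?j ?i"
      by (rule second_derivative_symmetric[OF H.open_domain H.smooth ux])
    finally show ?thesis .
  qed
  have amb: "lorentz_product (?dy (ambient_derivative H.g u i j x)) (H.d e (u x)) = lorentz_product (dd x j i) (H.d e (u x))"
    for i j e
    by (simp add: ambient_derivative_def linear_add[OF lin_y] lorentz.add_left \<Gamma> dd_eq)
  have G: "inverse_metric (pull_back H.g u) x = ginv x"
  proof -
    have "metric_matrix (pull_back H.g u) x = gmat x"
      by (simp add: metric_matrix_def pull_back_def minkowski_eq d\<psi>)
    then show ?thesis by (simp add: inverse_metric_def)
  qed
  define a where "a = (\<Sum>i\<in>UNIV. \<Sum>j\<in>UNIV. ginv x $ i $ j *\<^sub>R ambient_derivative H.g u i j x)"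
  \<comment> \<open>Here \<open>n\<close> is eliminated; nondegeneracy of \<open>H.gmat\<close> then
    turns equality of all pairings into \<open>a = ?du v\<close>.\<close>
  have "lorentz_product (?dy (a - ?du v)) (H.d e (u x)) = 0" for e
  proof -
    have "lorentz_product (?dy a) (H.d e (u x)) = lorentz_product (hessian_trace x) (H.d e (u x))"
      by (simp add: a_def hessian_trace_def linear_sum[OF lin_y] linear_scale[OF lin_y]
          lorentz.sum_left lorentz.scaleR_left amb)
    also have "\<dots> = lorentz_product (?dy (?du v)) (H.d e (u x))"
      using normal[of "axis e 1"] by (simp add: trace lorentz.add_left d\<psi> partial_deriv_def)
    finally show ?thesis by (simp add: linear_diff[OF lin_y] lorentz.diff_left)
  qed
  then have "H.gmat (u x) *v (a - ?du v) = 0" by (simp add: vec_eq_iff H.gmat_mult[OF ux])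
  then have "matrix_inv (H.gmat (u x)) *v (H.gmat (u x) *v (a - ?du v)) = 0" by simp
  then have a: "a = ?du v"
    using matrix_inv_works(2)[OF H.det_nonzero[OF ux]] by (simp add: matrix_vector_mul_assoc)
  have tan: "tangential H.g u x w = (\<Sum>i\<in>UNIV. \<Sum>j\<in>UNIV.
      (ginv x $ i $ j * lorentz_product (?dy w) (d j x)) *\<^sub>R partial_deriv i u x)" for w
    by (simp add: tangential_def G pull_back_def minkowski_eq partial_deriv_def d\<psi>)
  then have lin_tan: "linear (tangential H.g u x)"
    by (intro linearI) (simp_all add: linear_add[OF lin_y] linear_scale[OF lin_y] lorentz.add_left
        lorentz.scaleR_left algebra_simps sum.distrib scaleR_sum_right)
  \<comment> \<open>The inverse metric undoes the pairing with the basis \<open>d j x\<close>, so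
    the projection fixes the image of \<open>?du\<close>.\<close>
  have "tangential H.g u x (?du v) = (\<Sum>i\<in>UNIV. v $ i *\<^sub>R partial_deriv i u x)"
  proof -
    have "(\<Sum>j\<in>UNIV. ginv x $ i $ j * lorentz_product (?dy (?du v)) (d j x)) = v $ i" for i
    proof -
      have "lorentz_product (?dy (?du v)) (d j x) = (gmat x *v v) $ j" for j
        by (simp add: gmat_mult[OF x] d\<psi>)
      then have "(\<Sum>j\<in>UNIV. ginv x $ i $ j * lorentz_product (?dy (?du v)) (d j x)) = (ginv x *v (gmat x *v v)) $ i"
        by (simp add: matrix_vector_mult_def)
      then show ?thesis
        using matrix_inv_works(2)[OF det_nonzero[OF x]]
        by (simp add: matrix_vector_mul_assoc inverse_metric_def)
    qed
    then show ?thesis by (simp add: tan scaleR_sum_left[symmetric])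
  qed
  also have "\<dots> = ?du v"
    using linear_axis_expand[OF lin_u, of v] by (simp add: partial_deriv_def)
  finally have "tangential H.g u x a = a" by (simp add: a)
  moreover have "mean_curvature_vector H.g u x = (1 / real CARD('k)) *\<^sub>R (a - tangential H.g u x a)"
    by (simp add: mean_curvature_vector_def second_fundamental_form_def G a_def linear_sum[OF lin_tan]
        linear_scale[OF lin_tan] sum_subtractf scaleR_diff_right)
  ultimately show ?thesis by simp
qed

end

section \<open>Passage between charts\<close>

lemma smooth_manifold_chart:
  assumes "smooth_manifold X A" "c \<in> A"
  shows "openin X (fst c)" "open (chart_image c)" "inj_on (snd c) (fst c)"
    "homeomorphic_map (subtopology X (fst c)) (top_of_set (chart_image c)) (snd c)"
proof -
  have *: "openin X (fst c) \<and> open (chart_image c) \<and>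
      homeomorphic_map (subtopology X (fst c)) (top_of_set (chart_image c)) (snd c)"
    using assms unfolding smooth_manifold_def chart_image_def by (cases c) auto
  then show "openin X (fst c)" "open (chart_image c)"
    "homeomorphic_map (subtopology X (fst c)) (top_of_set (chart_image c)) (snd c)" by auto
  have "topspace (subtopology X (fst c)) = fst c"
    using * openin_subset by (auto simp: topspace_subtopology)
  then show "inj_on (snd c) (fst c)"
    using * homeomorphic_imp_injective_map by metis
qed

lemma in_chart_apply:
  "smooth_manifold X A \<Longrightarrow> c \<in> A \<Longrightarrow> p \<in> fst c \<Longrightarrow> in_chart c f (snd c p) = f p"
  by (simp add: in_chart_def smooth_manifold_chart(3))

lemma open_chart_overlap:
  assumes "smooth_manifold X A" "c \<in> A" "c' \<in> A"
  shows "open (snd c ` (fst c \<inter> fst c'))"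
proof -
  note c = smooth_manifold_chart[OF assms(1,2)] and c' = smooth_manifold_chart[OF assms(1,3)]
  have "openin (subtopology X (fst c)) (fst c \<inter> fst c')"
    using c'(1) by (simp add: openin_subtopology_Int2 Int_commute)
  then have "openin (top_of_set (chart_image c)) (snd c ` (fst c \<inter> fst c'))"
    using homeomorphic_imp_open_map[OF c(4)] by (simp add: open_map_def)
  then show ?thesis using c(2) by (simp add: openin_open_eq)
qed

lemma chart_transition:
  assumes "smooth_manifold X A" "c \<in> A" "c' \<in> A"
  defines "\<tau> \<equiv> snd c' \<circ> inv_into (fst c) (snd c)"
  shows "smooth_on (snd c ` (fst c \<inter> fst c')) \<tau>"
    and "\<tau> ` (snd c ` (fst c \<inter> fst c')) \<subseteq> chart_image c'"
    and "\<And>z. z \<in> snd c ` (fst c \<inter> fst c') \<Longrightarrow> in_chart c f z = in_chart c' f (\<tau> z)"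
    and "\<And>p. p \<in> fst c \<Longrightarrow> \<tau> (snd c p) = snd c' p"
proof -
  note inj = smooth_manifold_chart(3)[OF assms(1,2)]
  show "smooth_on (snd c ` (fst c \<inter> fst c')) \<tau>"
    using assms(1-3) unfolding smooth_manifold_def \<tau>_def by (cases c; cases c') fastforce
  show \<tau>: "\<tau> (snd c p) = snd c' p" if "p \<in> fst c" for p
    using inj that by (simp add: \<tau>_def)
  show "\<tau> ` (snd c ` (fst c \<inter> fst c')) \<subseteq> chart_image c'"
    by (auto simp: \<tau> chart_image_def)
  show "in_chart c f z = in_chart c' f (\<tau> z)" if "z \<in> snd c ` (fst c \<inter> fst c')" for z
    using that by (auto simp: \<tau> in_chart_apply[OF assms(1,2)] in_chart_apply[OF assms(1,3)])
qed

lemma smooth_manifold_chart_at: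
  assumes "smooth_manifold X A" "p \<in> topspace X"
  shows "chart_at A p \<in> A" "p \<in> fst (chart_at A p)"
proof -
  have "p \<in> (\<Union>(U, \<phi>)\<in>A. U)" using assms unfolding smooth_manifold_def by simp
  then have "\<exists>c. c \<in> A \<and> p \<in> fst c" by auto
  from someI_ex[OF this] show "chart_at A p \<in> A" "p \<in> fst (chart_at A p)"
    by (auto simp: chart_at_def)
qed

section \<open>The differential equation in charts\<close>

locale position_laplace_immersion =
  fixes J :: "real set" and r :: "real \<Rightarrow> real"
    and X :: "'a topology" and A :: "('a, 'k::finite) chart set"
    and \<Psi> :: "'a \<Rightarrow> 'm::finite minkowski_space"
  assumes open_J: "open J" and adm: "admissible J r"
    and manifold: "smooth_manifold X A" and immersion: "spacelike_immersion A \<Psi>"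
    and time_range: "p \<in> topspace X \<Longrightarrow> fst (\<Psi> p) \<in> J"
    and q_pos: "p \<in> topspace X \<Longrightarrow> q_fun r A \<Psi> p > 0"
    and laplace_eq: "p \<in> topspace X \<Longrightarrow> vector_laplacian A \<Psi> p + q_fun r A \<Psi> p *\<^sub>R P_field r \<Psi> p = 0"
begin

lemma smooth_J: "smooth_on J r"
  using adm by (simp add: admissible_def)

lemma chart_immersion:
  assumes "c \<in> A"
  shows "nondegenerate_immersion (chart_image c) (in_chart c \<Psi>)"
    and "x \<in> chart_image c \<Longrightarrow> spacelike_immersive_at minkowski (in_chart c \<Psi>) x"
proof -
  have sm: "smooth_on (chart_image c) (in_chart c \<Psi>)"
    and sp: "\<And>x. x \<in> chart_image c \<Longrightarrow> spacelike_immersive_at minkowski (in_chart c \<Psi>) x"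
    using immersion assms unfolding spacelike_immersion_def by auto
  then show "x \<in> chart_image c \<Longrightarrow> spacelike_immersive_at minkowski (in_chart c \<Psi>) x" by simp
  show "nondegenerate_immersion (chart_image c) (in_chart c \<Psi>)"
  proof (rule nondegenerate_immersionI[OF smooth_manifold_chart(2)[OF manifold assms] sm])
    fix x v
    assume "x \<in> chart_image c" and
      "\<And>w. lorentz_product (frechet_derivative (in_chart c \<Psi>) (at x) v) (frechet_derivative (in_chart c \<Psi>) (at x) w) = 0"
    then show "v = 0"
      using sp[of x] unfolding spacelike_immersive_at_def pull_back_def minkowski_eq by fastforce
  qed
qed

lemma chart_subset: "c \<in> A \<Longrightarrow> p \<in> fst c \<Longrightarrow> p \<in> topspace X"
  using smooth_manifold_chart(1)[OF manifold] openin_subset by blast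

lemma vector_laplacian_chart_at:
  "vector_laplacian A \<Psi> p = nondegenerate_immersion.vector_laplace_beltrami (in_chart (chart_at A p) \<Psi>) (snd (chart_at A p) p)"
  if "p \<in> topspace X"
proof -
  let ?c = "chart_at A p"
  interpret N: nondegenerate_immersion "chart_image ?c" "in_chart ?c \<Psi>"
    by (rule chart_immersion(1)[OF smooth_manifold_chart_at(1)[OF manifold that]])
  show ?thesis
    unfolding vector_laplacian_def laplacian_def Let_def N.vector_laplace_beltrami_def induced_metric_def
    by (simp add: in_chart_def comp_def)
qed

lemma P_field_eq: "P_field r \<Psi> p = position_normal r (\<Psi> p)"
  by (simp add: P_field_def position_normal_def)

lemma laplace_chart_at:
  assumes "p \<in> topspace X"
  defines "\<psi> \<equiv> in_chart (chart_at A p) \<Psi>" and "x \<equiv> snd (chart_at A p) p"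
  shows "nondegenerate_immersion.hessian_trace \<psi> x + (\<Sum>j\<in>UNIV. nondegenerate_immersion.drift \<psi> x j *\<^sub>R partial_deriv j \<psi> x)
      = - q_fun r A \<Psi> p *\<^sub>R position_normal r (\<Psi> p)"
    and "lorentz_product (position_normal r (\<Psi> p)) (frechet_derivative \<psi> (at x) v) = 0"
proof -
  let ?c = "chart_at A p"
  note c = smooth_manifold_chart_at[OF manifold assms(1)]
  interpret N: nondegenerate_immersion "chart_image ?c" \<psi>
    unfolding \<psi>_def by (rule chart_immersion(1)[OF c(1)])
  have x: "x \<in> chart_image ?c" using c(2) by (simp add: x_def chart_image_def)
  have L: "N.vector_laplace_beltrami x = - q_fun r A \<Psi> p *\<^sub>R position_normal r (\<Psi> p)"
    using laplace_eq[OF assms(1)] vector_laplacian_chart_at[OF assms(1)]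
    by (simp add: \<psi>_def x_def P_field_eq eq_neg_iff_add_eq_0)
  then show "N.hessian_trace x + (\<Sum>j\<in>UNIV. N.drift x j *\<^sub>R partial_deriv j \<psi> x)
      = - q_fun r A \<Psi> p *\<^sub>R position_normal r (\<Psi> p)"
    by (simp add: N.vector_laplace_beltrami_eq[OF x])
  have "lorentz_product (position_normal r (\<Psi> p)) (partial_deriv j \<psi> x) = 0" for j
    using N.vector_laplace_beltrami_normal[OF x, of j] q_pos[OF assms(1)]
    by (simp add: L lorentz.minus_left lorentz.scaleR_left)
  then show "lorentz_product (position_normal r (\<Psi> p)) (frechet_derivative \<psi> (at x) v) = 0"
    by (subst linear_axis_expand[OF N.linear_frechet[OF x]])
      (simp add: lorentz.sum_right lorentz.scaleR_right partial_deriv_def)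
qed

text \<open>Freed from the selected chart, the equation survives modulo tangent vectors, and
  normality survives because both charts give the same tangent space.\<close>

lemma laplace_chart:
  assumes c: "c \<in> A" "p \<in> fst c"
  defines "\<psi> \<equiv> in_chart c \<Psi>" and "x \<equiv> snd c p"
  shows "\<exists>v. nondegenerate_immersion.hessian_trace \<psi> x =
      - q_fun r A \<Psi> p *\<^sub>R position_normal r (\<Psi> p) + frechet_derivative \<psi> (at x) v"
    and "lorentz_product (position_normal r (\<Psi> p)) (frechet_derivative \<psi> (at x) v) = 0"
proof -
  let ?c = "chart_at A p"
  have p: "p \<in> topspace X" by (rule chart_subset[OF c])
  note c' = smooth_manifold_chart_at[OF manifold p]
  define \<tau> where "\<tau> = snd ?c \<circ> inv_into (fst c) (snd c)"
  note tr = chart_transition[OF manifold c(1) c'(1), folded \<tau>_def]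
  let ?S = "snd c ` (fst c \<inter> fst ?c)"
  interpret C: nondegenerate_immersion "chart_image c" \<psi>
    unfolding \<psi>_def by (rule chart_immersion(1)[OF c(1)])
  have sub: "?S \<subseteq> chart_image c" by (auto simp: chart_image_def)
  \<comment> \<open>The transition map is controlled on the overlap only. Passing to it leaves
    \<open>hessian_trace\<close> unchanged, as that depends on \<open>\<psi>\<close> alone.\<close>
  interpret N: nondegenerate_immersion ?S \<psi>
    using open_chart_overlap[OF manifold c(1) c'(1)] smooth_on_subset[OF C.smooth sub] C.det_nonzero sub
    by unfold_locales auto
  interpret N0: nondegenerate_immersion "chart_image ?c" "in_chart ?c \<Psi>"
    by (rule chart_immersion(1)[OF c'(1)])
  have x: "x \<in> ?S" using c(2) c'(2) by (auto simp: x_def)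
  have \<tau>x: "\<tau> x = snd ?c p" using tr(4)[OF c(2)] by (simp add: x_def)
  have eq: "\<psi> z = in_chart ?c \<Psi> (\<tau> z)" if "z \<in> ?S" for z
    unfolding \<psi>_def by (rule tr(3)[OF that])
  note rep = N.hessian_trace_reparametrize[OF N0.nondegenerate_immersion_axioms tr(1,2) eq x, unfolded \<tau>x]
  note L = laplace_chart_at[OF p]
  have x0: "snd ?c p \<in> chart_image ?c" using c'(2) by (simp add: chart_image_def)
  have "frechet_derivative \<psi> (at x) v \<in> range (frechet_derivative (in_chart ?c \<Psi>) (at (snd ?c p)))"
    using rep(2) by blast
  then show "lorentz_product (position_normal r (\<Psi> p)) (frechet_derivative \<psi> (at x) v) = 0"
    using L(2) by auto
  obtain v where v: "N.hessian_trace x = N0.hessian_trace (snd ?c p)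
      + frechet_derivative (in_chart ?c \<Psi>) (at (snd ?c p)) v"
    using rep(1) by blast
  \<comment> \<open>Collects both tangential corrections: \<open>v\<close> from the change of chart
    and the drift from the Laplacian.\<close>
  let ?w = "v - (\<chi> j. N0.drift (snd ?c p) j)"
  have lin: "linear (frechet_derivative (in_chart ?c \<Psi>) (at (snd ?c p)))" by (rule N0.linear_frechet[OF x0])
  have "frechet_derivative (in_chart ?c \<Psi>) (at (snd ?c p)) (\<chi> j. N0.drift (snd ?c p) j) =
      (\<Sum>j\<in>UNIV. N0.drift (snd ?c p) j *\<^sub>R partial_deriv j (in_chart ?c \<Psi>) (snd ?c p))"
    by (subst linear_axis_expand[OF lin]) (simp add: partial_deriv_def)
  then have "N.hessian_trace x = - q_fun r A \<Psi> p *\<^sub>R position_normal r (\<Psi> p)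
      + frechet_derivative (in_chart ?c \<Psi>) (at (snd ?c p)) ?w"
    using v L(1) by (simp add: linear_diff[OF lin] algebra_simps)
  moreover have "frechet_derivative (in_chart ?c \<Psi>) (at (snd ?c p)) ?w \<in> range (frechet_derivative \<psi> (at x))"
    using rep(2) by blast
  ultimately show "\<exists>v. N.hessian_trace x =
      - q_fun r A \<Psi> p *\<^sub>R position_normal r (\<Psi> p) + frechet_derivative \<psi> (at x) v"
    by auto
qed

text \<open>All differentiation takes place in the chart selected at \<open>p\<close>. At its other
  points, where \<open>chart_at\<close> may select differently, normality is supplied by
  \<open>laplace_chart\<close>. Pairing with P removes the unknown tangent vector from the Hessian
  trace, and q > 0 is cancelled.\<close>

lemma in_hypersurface:
  assumes p: "p \<in> topspace X"
  shows "\<Psi> p \<in> Q J r"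
proof -
  let ?c = "chart_at A p"
  let ?x = "snd ?c p"
  let ?\<psi> = "in_chart ?c \<Psi>"
  let ?t = "fst (\<Psi> p)"
  let ?P = "position_normal r (\<Psi> p)"
  note c = smooth_manifold_chart_at[OF manifold p]
  interpret N: nondegenerate_immersion "chart_image ?c" ?\<psi> by (rule chart_immersion(1)[OF c(1)])
  have x: "?x \<in> chart_image ?c" using c(2) by (simp add: chart_image_def)
  have \<psi>x: "?\<psi> ?x = \<Psi> p" by (rule in_chart_apply[OF manifold c])
  have pt: "\<exists>p. p \<in> fst ?c \<and> z = snd ?c p \<and> ?\<psi> z = \<Psi> p" if "z \<in> chart_image ?c" for z
    using that in_chart_apply[OF manifold c(1)] by (auto simp: chart_image_def)
  let ?s = "\<Sum>i\<in>UNIV. \<Sum>j\<in>UNIV. N.ginv ?x $ i $ j *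
        (partial_deriv i (\<lambda>z. fst (?\<psi> z)) ?x * partial_deriv j (\<lambda>z. fst (?\<psi> z)) ?x)"
  have "lorentz_product (position_normal r (?\<psi> ?x)) (N.hessian_trace ?x) + real CARD('k) =
      (deriv (deriv r) (fst (?\<psi> ?x)) * r (fst (?\<psi> ?x)) + (deriv r (fst (?\<psi> ?x)))\<^sup>2 - 1) * ?s"
  proof (rule N.position_normal_trace_identity[OF open_J smooth_J _ _ x])
    fix z assume "z \<in> chart_image ?c"
    then obtain p' where p': "p' \<in> fst ?c" "z = snd ?c p'" "?\<psi> z = \<Psi> p'" using pt by blast
    show "fst (?\<psi> z) \<in> J" using time_range[OF chart_subset[OF c(1) p'(1)]] p'(3) by simp
    show "lorentz_product (position_normal r (?\<psi> z)) (partial_deriv i ?\<psi> z) = 0" for i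
      using laplace_chart(2)[OF c(1) p'(1)] p'(2,3) by (simp add: partial_deriv_def)
  qed
  then have id: "lorentz_product ?P (N.hessian_trace ?x) + real CARD('k) =
      (deriv (deriv r) ?t * r ?t + (deriv r ?t)\<^sup>2 - 1) * ?s"
    by (simp only: \<psi>x)
  have "(gradient_norm A (induced_metric \<Psi>) (\<lambda>q. fst (\<Psi> q)) p)\<^sup>2 =
      (sqrt (N.g ?x (gradient N.g (\<lambda>z. fst (?\<psi> z)) ?x) (gradient N.g (\<lambda>z. fst (?\<psi> z)) ?x)))\<^sup>2"
    by (simp add: gradient_norm_def Let_def induced_metric_def in_chart_def comp_def)
  also have "\<dots> = N.g ?x (gradient N.g (\<lambda>z. fst (?\<psi> z)) ?x) (gradient N.g (\<lambda>z. fst (?\<psi> z)) ?x)"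
  \<comment> \<open>Positivity of the induced metric enters here: \<open>gradient_norm\<close> is a
    square root, and squaring it needs a nonnegative radicand.\<close>
  proof (rule real_sqrt_pow2)
    have "N.g ?x v v \<ge> 0" for v
      using chart_immersion(2)[OF c(1) x] N.g_eq[OF x, of v v]
      unfolding spacelike_immersive_at_def by (cases "v = 0") (auto simp: less_imp_le)
    then show "N.g ?x (gradient N.g (\<lambda>z. fst (?\<psi> z)) ?x) (gradient N.g (\<lambda>z. fst (?\<psi> z)) ?x) \<ge> 0" .
  qed
  also have "\<dots> = ?s" by (rule N.gradient_square[OF x])
  finally have grad: "(gradient_norm A (induced_metric \<Psi>) (\<lambda>q. fst (\<Psi> q)) p)\<^sup>2 = ?s" .
  let ?q = "q_fun r A \<Psi> p"
  have "?q * ((r ?t)\<^sup>2 * (1 - (deriv r ?t)\<^sup>2)) =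
      real CARD('k) - (deriv (deriv r) ?t * r ?t + (deriv r ?t)\<^sup>2 - 1) * ?s"
    using admissible_nonzero[OF adm time_range[OF p]] by (simp add: q_fun_def Let_def grad)
  also have "\<dots> = - lorentz_product ?P (N.hessian_trace ?x)"
    using id by linarith
  also have "\<dots> = ?q * lorentz_product ?P ?P"
  proof -
    obtain v where "N.hessian_trace ?x = - ?q *\<^sub>R ?P + frechet_derivative ?\<psi> (at ?x) v"
      using laplace_chart(1)[OF c] by blast
    then show ?thesis
      using laplace_chart(2)[OF c, of v]
      by (simp add: lorentz.add_right lorentz.diff_right lorentz.minus_right lorentz.scaleR_right)
  qed
  finally have "(r ?t)\<^sup>2 * (1 - (deriv r ?t)\<^sup>2) = lorentz_product ?P ?P"
    using q_pos[OF p] by simp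
  then show ?thesis
    using time_range[OF p] by (simp add: mem_Q position_normal_square algebra_simps)
qed

section \<open>The map into the hypersurface: regularity and stationarity\<close>

lemma continuous_into: "continuous_map X (top_of_set (Q J r)) \<Psi>"
proof -
  have "continuous_map X euclidean \<Psi>"
  proof (rule pasting_lemma[where I = A and T = fst and f = "\<lambda>_. \<Psi>"])
    fix c assume c: "c \<in> A"
    show "openin X (fst c)" by (rule smooth_manifold_chart(1)[OF manifold c])
    interpret N: nondegenerate_immersion "chart_image c" "in_chart c \<Psi>" by (rule chart_immersion(1)[OF c])
    have "continuous_map (subtopology X (fst c)) (top_of_set (chart_image c)) (snd c)"
      using smooth_manifold_chart(4)[OF manifold c] by (rule homeomorphic_imp_continuous_map)
    moreover have "continuous_map (top_of_set (chart_image c)) euclidean (in_chart c \<Psi>)"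
      using smooth_on_continuous[OF N.smooth] by simp
    ultimately have "continuous_map (subtopology X (fst c)) euclidean (in_chart c \<Psi> \<circ> snd c)"
      by (rule continuous_map_compose)
    then show "continuous_map (subtopology X (fst c)) euclidean \<Psi>"
      by (rule continuous_map_eq) (auto simp: in_chart_apply[OF manifold c])
  next
    fix p assume "p \<in> topspace X"
    then show "\<exists>c. c \<in> A \<and> p \<in> fst c \<and> \<Psi> p = \<Psi> p"
      using smooth_manifold_chart_at[OF manifold] by blast
  qed simp
  then show ?thesis
    using in_hypersurface by (auto simp: continuous_map_in_subtopology)
qed

text \<open>On the image of \<open>V\<close> the function \<open>inv_into V y\<close> coincides with
  the continuous inverse \<open>y'\<close>, so \<open>u\<close> is continuous, and
  \<open>smooth_on_lift\<close> raises this to smoothness.\<close>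

lemma local_expression:
  assumes c: "c \<in> A" and y: "local_parametrization (Q J r) V y"
  defines "D \<equiv> local_domain c V y \<Psi>" and "u \<equiv> local_expression c V y \<Psi>"
  shows "open D" "smooth_on D u" "u ` D \<subseteq> V" "\<And>x. x \<in> D \<Longrightarrow> in_chart c \<Psi> x = y (u x)"
proof -
  interpret N: nondegenerate_immersion "chart_image c" "in_chart c \<Psi>" by (rule chart_immersion(1)[OF c])
  have V: "open V" "smooth_on V y" "\<And>z. z \<in> V \<Longrightarrow> inj (frechet_derivative y (at z))"
    "openin (top_of_set (Q J r)) (y ` V)" and "\<exists>y'. homeomorphism V (y ` V) y y'"
    using y by (auto simp: local_parametrization_def)
  then obtain y' where y': "homeomorphism V (y ` V) y y'" by blast
  have inQ: "in_chart c \<Psi> x \<in> Q J r" if "x \<in> chart_image c" for x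
    using that in_hypersurface[OF chart_subset[OF c]] in_chart_apply[OF manifold c, of _ \<Psi>]
    by (auto simp: chart_image_def)
  \<comment> \<open>Since \<open>\<Psi>\<close> already takes values in Q(r), the relatively open
    image of \<open>V\<close> can be replaced by the ambient open set \<open>W\<close>, which
    exhibits \<open>D\<close> as an open preimage.\<close>
  obtain W where W: "open W" "y ` V = Q J r \<inter> W" using V(4) by (auto simp: openin_open)
  have "D = chart_image c \<inter> in_chart c \<Psi> -` W"
    using inQ by (auto simp: D_def local_domain_def W(2))
  then show D: "open D"
    using continuous_open_preimage[OF smooth_on_continuous[OF N.smooth] N.open_domain W(1)] by simp
  have sub: "D \<subseteq> chart_image c" by (auto simp: D_def local_domain_def)
  show u: "u ` D \<subseteq> V"
    by (auto simp: D_def u_def local_domain_def local_expression_def inv_into_into)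
  show yu: "in_chart c \<Psi> x = y (u x)" if "x \<in> D" for x
    using that by (simp add: D_def u_def local_domain_def local_expression_def f_inv_into_f)
  have u_eq: "u x = y' (in_chart c \<Psi> x)" if "x \<in> D" for x
    using yu[OF that] u that y' by (auto simp: homeomorphism_def)
  have "continuous_on D (\<lambda>x. y' (in_chart c \<Psi> x))"
  proof (rule continuous_on_compose2[of "y ` V" y'])
    show "continuous_on (y ` V) y'" using y' by (simp add: homeomorphism_def)
    show "continuous_on D (in_chart c \<Psi>)"
      using smooth_on_continuous[OF N.smooth] sub by (rule continuous_on_subset)
    show "in_chart c \<Psi> ` D \<subseteq> y ` V" by (auto simp: D_def local_domain_def)
  qed
  then have "continuous_on D u" using u_eq by (simp cong: continuous_on_cong)
  then show "smooth_on D u"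
    by (intro smooth_on_lift[OF V(1-3) D smooth_on_subset[OF N.smooth sub] u]) (auto simp: yu)
qed

text \<open>The differential of \<open>\<Psi>\<close> factors as that of \<open>y\<close> after that
  of \<open>?u\<close>, and \<open>y\<close> is isometric for its pulled back metric. Injectivity
  and positivity therefore pass to \<open>?u\<close>.\<close>

lemma spacelike_immersion_into_hypersurface: "spacelike_immersion_into (Q J r) X A \<Psi>"
  unfolding spacelike_immersion_into_def
proof (intro conjI ballI allI impI)
  show "continuous_map X (top_of_set (Q J r)) \<Psi>" by (rule continuous_into)
  fix c V and y :: "real^'m \<Rightarrow> 'm minkowski_space"
  assume c: "c \<in> A" and y: "local_parametrization (Q J r) V y"
  let ?u = "local_expression c V y \<Psi>"
  note u = local_expression[OF c y]
  show "smooth_on (local_domain c V y \<Psi>) ?u" by (rule u(2))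
  fix x assume x: "x \<in> local_domain c V y \<Psi>"
  interpret H: nondegenerate_immersion V y by (rule local_parametrization_Q(1)[OF open_J adm y])
  have xc: "x \<in> chart_image c" using x by (simp add: local_domain_def)
  have ux: "?u x \<in> V" using u(3) x by auto
  interpret N: nondegenerate_immersion "chart_image c" "in_chart c \<Psi>" by (rule chart_immersion(1)[OF c])
  have "((\<lambda>z. y (?u z)) has_derivative frechet_derivative (in_chart c \<Psi>) (at x)) (at x)"
    by (rule has_derivative_transform_within_open[OF smooth_on_has_derivative[OF N.smooth xc] u(1) x u(4)])
  from frechet_derivative_at[OF this]
  have d: "frechet_derivative (in_chart c \<Psi>) (at x) v =
      frechet_derivative y (at (?u x)) (frechet_derivative ?u (at x) v)" for v
    by (simp add: frechet_derivative_compose_smooth[OF u(2) H.smooth x ux])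
  show "spacelike_immersive_at (pull_back minkowski y) ?u x"
    using chart_immersion(2)[OF c xc]
    unfolding spacelike_immersive_at_def pull_back_def minkowski_eq d
    using inj_on_imageI2[of "frechet_derivative y (at (?u x))" "frechet_derivative ?u (at x)" UNIV]
    by (simp add: comp_def)
qed

text \<open>\<open>mean_curvature_vector_eq_0\<close> applies with normal vector -q P, the Hessian
  trace being known modulo vectors tangent to M.\<close>

lemma stationary_in_hypersurface: "stationary_in (Q J r) A \<Psi>"
  unfolding stationary_in_def
proof (intro ballI allI impI)
  fix c V and y :: "real^'m \<Rightarrow> 'm minkowski_space" and x
  assume c: "c \<in> A" and y: "local_parametrization (Q J r) V y" and x: "x \<in> local_domain c V y \<Psi>"
  let ?u = "local_expression c V y \<Psi>"
  let ?D = "local_domain c V y \<Psi>"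
  note u = local_expression[OF c y]
  interpret C: nondegenerate_immersion "chart_image c" "in_chart c \<Psi>" by (rule chart_immersion(1)[OF c])
  have sub: "?D \<subseteq> chart_image c" by (auto simp: local_domain_def)
  interpret N: nondegenerate_immersion ?D "in_chart c \<Psi>"
    using u(1) smooth_on_subset[OF C.smooth sub] C.det_nonzero sub by unfold_locales auto
  obtain p where p: "p \<in> fst c" "x = snd c p" using x sub by (auto simp: chart_image_def)
  have \<Psi>p: "y (?u x) = \<Psi> p"
    using u(4)[OF x] in_chart_apply[OF manifold c p(1)] p(2) by metis
  obtain v where "C.hessian_trace x = - q_fun r A \<Psi> p *\<^sub>R position_normal r (\<Psi> p)
      + frechet_derivative (in_chart c \<Psi>) (at x) v"
    using laplace_chart(1)[OF c p(1)] p(2) by blast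
  moreover have "lorentz_product (- q_fun r A \<Psi> p *\<^sub>R position_normal r (\<Psi> p))
      (frechet_derivative y (at (?u x)) w) = 0" for w
    using local_parametrization_Q(2)[OF open_J adm y, of "?u x" w] u(3) x
    by (auto simp: \<Psi>p lorentz.scaleR_left lorentz.minus_left)
  ultimately show "mean_curvature_vector (pull_back minkowski y) ?u x = 0"
    by (intro N.mean_curvature_vector_eq_0[OF local_parametrization_Q(1)[OF open_J adm y] u(2-4) x])
qed

end

theorem theorem4p7:
  fixes J :: "real set" and r :: "real \<Rightarrow> real"
    and X :: "'a topology" and A :: "('a, 'k::finite) chart set"
    and \<Psi> :: "'a \<Rightarrow> 'm::finite minkowski_space"
  assumes "open J" and "is_interval J" and "0 \<in> J"
    and "admissible J r"
    and "smooth_manifold X A"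
    and "spacelike_immersion A \<Psi>"
    and "\<forall>p\<in>topspace X. fst (\<Psi> p) \<in> J"
    and "\<forall>p\<in>topspace X. q_fun r A \<Psi> p > 0"
    and "\<forall>p\<in>topspace X. vector_laplacian A \<Psi> p + q_fun r A \<Psi> p *\<^sub>R P_field r \<Psi> p = 0"
  shows "\<Psi> ` topspace X \<subseteq> Q J r \<and> spacelike_immersion_into (Q J r) X A \<Psi> \<and>
    stationary_in (Q J r) A \<Psi>"
proof -
  interpret position_laplace_immersion J r X A \<Psi>
    using assms by unfold_locales auto
  show ?thesis
    using in_hypersurface spacelike_immersion_into_hypersurface stationary_in_hypersurface by blast
qed

end
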